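(* Let $0<p<1/2$, $\rho=(1-p)/p$, $\phi=1/\rho$, $0<\alpha_\pm<1$, $0<\delta_\pm\le1$, $\lambda\ge1$. Consider the merged problem (MP): maximize $$v_M(z_{+,1},z_{-,1},s_+,s_-)=(v_+^*(s_+)+1)(z_{+,1})^{\delta_+}-\lambda(v_-^*(s_-)+1)(z_{-,1})^{\delta_-}$$ subject to $0\le z_{+,1}\le1$, $0\le z_{-,1}\le1$, $z_{+,1}+z_{-,1}\le1$, $0\le s_+<\infty$, $0\le s_-<\frac{\phi}{1-\phi}$, and $(s_++1)z_{+,1}=\phi(s_-+1)z_{-,1}$. For given $s_+,s_-$ let $$f(y)=f_{s_+,s_-}(y)=(v_+^*(s_+)+1)\phi^{\delta_+}\Big(\frac{s_-+1}{s_++1}\Big)^{\delta_+}y^{\delta_+}-\lambda(v_-^*(s_-)+1)y^{\delta_-}.$$ (i) Suppose $\delta_+\ge\delta_-$. Let $$M=\sup_{0\le s_+<\infty,\ 0\le s_-<\frac{\phi}{1-\phi}}\frac{(v_+^*(s_+)+1)\phi^{\delta_+}(s_-+1)^{\delta_+}}{(v_-^*(s_-)+1)(s_++1)^{\delta_-}(s_++1+\phi(s_-+1))^{\delta_+-\delta_-}}.$$ (a) If $\lambda\ge M$, the optimal solution to (MP) is $z_{+,1}^*=z_{-,1}^*=0$, meaning that the gambler does not enter the game at all. (b) If $\lambda<M$, the gambler will enter the game, and the optimal solution to (MP) is given by $$(s_+^*,s_-^* )\in\operatorname*{arg\,sup}_{0\le s_+<\infty,\ 0\le s_-<\frac{\phi}{1-\phi}}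 f_{s_+,s_-}\Big(\frac{s_++1}{s_++1+\phi(s_-+1)}\Big),$$ $$z_{+,1}^*=\frac{\phi(s_-^*+1)}{s_+^*+1+\phi(s_-^*+1)},\qquad z_{-,1}^*=\frac{s_+^*+1}{s_+^*+1+\phi(s_-^*+1)}.$$ (ii) Suppose $\delta_+<\delta_-$. The gambler will enter the game, and the optimal solution to (MP) is given by $$(s_+^*,s_-^* )\in\operatorname*{arg\,sup}_{0\le s_+<\infty,\ 0\le s_-<\frac{\phi}{1-\phi}} f_{s_+,s_-}(k(s_+,s_-)),\quad z_{+,1}^*=\phi\frac{s_-^*+1}{s_+^*+1}k(s_+^*,s_-^* ),\quad z_{-,1}^*=k(s_+^*,s_-^* ),$$ where $$k(s_+,s_-)=\min\left\{\Big(\frac{\delta_+(v_+^*(s_+)+1)\phi^{\delta_+}(s_-+1)^{\delta_+}}{\lambda\delta_-(v_-^*(s_-)+1)(s_++1)^{\delta_+}}\Big)^{\frac1{\delta_--\delta_+}},\ \frac{s_++1}{s_++1+\phi(s_-+1)}\right\}.$$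
   Context: $v_+^*(s)$, $s\ge0$, is the supremum of $\sum_{n=1}^\infty\big((n+1)^{\alpha_+}-n^{\alpha_+}\big)z_n^{\delta_+}$ over sequences with $1\ge z_1\ge z_2\ge\dots\ge0$ and $\sum_{n=1}^\infty\rho^n z_n=s$. $v_-^*(s)$, $0\le s<\phi/(1-\phi)$, is the infimum of $\sum_{n=1}^\infty\big((n+1)^{\alpha_-}-n^{\alpha_-}\big)z_n^{\delta_-}$ over sequences with $1\ge z_1\ge z_2\ge\dots\ge0$, $\sum_{n=1}^\infty z_n<\infty$ and $\sum_{n=1}^\infty\phi^n z_n=s$. "The gambler does not enter the game" means that $z_{+,1}=z_{-,1}=0$ is optimal in (MP); "the gambler will enter the game" means that optimal $(z_{+,1},z_{-,1})$ is not $(0,0)$. "$\arg\sup$" denotes the set of points where the supremum is attained. *)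

theory Defs
  imports "HOL-Analysis.Analysis"
begin

text \<open>Sequences are indexed from 1: only the values \<open>z (Suc n)\<close> matter and \<open>z 0\<close> is ignored.\<close>

definition unit_decreasing :: "(nat \<Rightarrow> real) \<Rightarrow> bool" where
  "unit_decreasing z \<longleftrightarrow> (\<forall>n\<ge>1. 0 \<le> z n \<and> z n \<le> 1 \<and> z (Suc n) \<le> z n)"

definition plus_feasible :: "real \<Rightarrow> real \<Rightarrow> (nat \<Rightarrow> real) set" where
  "plus_feasible \<rho> s = {z. unit_decreasing z \<and> (\<lambda>n. \<rho> ^ Suc n * z (Suc n)) sums s}"

definition minus_feasible :: "real \<Rightarrow> real \<Rightarrow> (nat \<Rightarrow> real) set" where
  "minus_feasible \<phi> s = {z. unit_decreasing z \<and> summable (\<lambda>n. z (Suc n)) \<and>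
     (\<lambda>n. \<phi> ^ Suc n * z (Suc n)) sums s}"

text \<open>The series is summed in \<^typ>\<open>ennreal\<close> because it may diverge on \<open>minus_feasible\<close>
  (for small \<open>\<delta>\<close>); such sequences then count with value \<open>\<infinity>\<close> in the infimum.\<close>

definition value_series :: "real \<Rightarrow> real \<Rightarrow> (nat \<Rightarrow> real) \<Rightarrow> ennreal" where
  "value_series \<alpha> \<delta> z =
     (\<Sum>n. ennreal ((real (Suc n + 1) powr \<alpha> - real (Suc n) powr \<alpha>) * z (Suc n) powr \<delta>))"

text \<open>The conversions to \<^typ>\<open>real\<close> below lose nothing in the range of interest.
  For \<open>\<rho> > 1\<close>, \<open>s \<ge> 0\<close> every element of \<open>plus_feasible \<rho> s\<close> satisfies \<open>z n \<le> s / \<rho> ^ n\<close>, so the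
  supremum is finite. For \<open>0 < \<phi> < 1\<close>, \<open>0 \<le> s < \<phi> / (1 - \<phi>)\<close> the set \<open>minus_feasible \<phi> s\<close>
  contains a sequence of finite support, so the infimum is finite.\<close>

definition v_plus :: "real \<Rightarrow> real \<Rightarrow> real \<Rightarrow> real \<Rightarrow> real" where
  "v_plus \<alpha> \<delta> \<rho> s = enn2real (SUP z\<in>plus_feasible \<rho> s. value_series \<alpha> \<delta> z)"

definition v_minus :: "real \<Rightarrow> real \<Rightarrow> real \<Rightarrow> real \<Rightarrow> real" where
  "v_minus \<alpha> \<delta> \<phi> s = enn2real (INF z\<in>minus_feasible \<phi> s. value_series \<alpha> \<delta> z)"

text \<open>In what follows \<open>vp\<close> and \<open>vm\<close> stand for the functions \<open>v\<^sub>+\<^sup>*\<close> and \<open>v\<^sub>-\<^sup>*\<close>, and points of the merged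
  problem are tuples \<open>(z\<^sub>+, z\<^sub>-, s\<^sub>+, s\<^sub>-)\<close>.\<close>

definition s_domain :: "real \<Rightarrow> (real \<times> real) set" where
  "s_domain \<phi> = {0..} \<times> {0..<\<phi> / (1 - \<phi>)}"

definition MP_feasible :: "real \<Rightarrow> real \<times> real \<times> real \<times> real \<Rightarrow> bool" where
  "MP_feasible \<phi> = (\<lambda>(zp, zm, sp, sm).
     0 \<le> zp \<and> zp \<le> 1 \<and> 0 \<le> zm \<and> zm \<le> 1 \<and> zp + zm \<le> 1 \<and>
     (sp, sm) \<in> s_domain \<phi> \<and> (sp + 1) * zp = \<phi> * (sm + 1) * zm)"

definition v_M :: "(real \<Rightarrow> real) \<Rightarrow> (real \<Rightarrow> real) \<Rightarrow> real \<Rightarrow> real \<Rightarrow> real \<Rightarrow>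
    real \<times> real \<times> real \<times> real \<Rightarrow> real" where
  "v_M vp vm \<delta>p \<delta>m lam = (\<lambda>(zp, zm, sp, sm).
     (vp sp + 1) * zp powr \<delta>p - lam * (vm sm + 1) * zm powr \<delta>m)"

definition MP_optimal :: "(real \<Rightarrow> real) \<Rightarrow> (real \<Rightarrow> real) \<Rightarrow> real \<Rightarrow> real \<Rightarrow> real \<Rightarrow> real \<Rightarrow>
    real \<times> real \<times> real \<times> real \<Rightarrow> bool" where
  "MP_optimal vp vm \<phi> \<delta>p \<delta>m lam = is_arg_max (v_M vp vm \<delta>p \<delta>m lam) (MP_feasible \<phi>)"

text \<open>When \<open>z\<^sub>+ = z\<^sub>- = 0\<close> the values of \<open>s\<^sub>+\<close> and \<open>s\<^sub>-\<close> are irrelevant.\<close>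

definition does_not_enter :: "(real \<Rightarrow> real) \<Rightarrow> (real \<Rightarrow> real) \<Rightarrow> real \<Rightarrow> real \<Rightarrow> real \<Rightarrow> real \<Rightarrow> bool"
  where "does_not_enter vp vm \<phi> \<delta>p \<delta>m lam \<longleftrightarrow>
     (\<forall>(sp, sm)\<in>s_domain \<phi>. MP_optimal vp vm \<phi> \<delta>p \<delta>m lam (0, 0, sp, sm))"

definition enters :: "(real \<Rightarrow> real) \<Rightarrow> (real \<Rightarrow> real) \<Rightarrow> real \<Rightarrow> real \<Rightarrow> real \<Rightarrow> real \<Rightarrow> bool"
  where "enters vp vm \<phi> \<delta>p \<delta>m lam \<longleftrightarrow>
     (\<exists>x. MP_optimal vp vm \<phi> \<delta>p \<delta>m lam x) \<and>
     (\<forall>zp zm sp sm. MP_optimal vp vm \<phi> \<delta>p \<delta>m lam (zp, zm, sp, sm) \<longrightarrow> (zp, zm) \<noteq> (0, 0))"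

definition arg_sup :: "('a \<Rightarrow> real) \<Rightarrow> 'a set \<Rightarrow> 'a set" where
  "arg_sup g D = {x \<in> D. ereal (g x) = (SUP y\<in>D. ereal (g y))}"

definition f_MP :: "(real \<Rightarrow> real) \<Rightarrow> (real \<Rightarrow> real) \<Rightarrow> real \<Rightarrow> real \<Rightarrow> real \<Rightarrow> real \<Rightarrow>
    real \<Rightarrow> real \<Rightarrow> real \<Rightarrow> real" where
  "f_MP vp vm \<phi> \<delta>p \<delta>m lam sp sm y =
     (vp sp + 1) * \<phi> powr \<delta>p * ((sm + 1) / (sp + 1)) powr \<delta>p * y powr \<delta>p
       - lam * (vm sm + 1) * y powr \<delta>m"

definition M_MP :: "(real \<Rightarrow> real) \<Rightarrow> (real \<Rightarrow> real) \<Rightarrow> real \<Rightarrow> real \<Rightarrow> real \<Rightarrow> ereal" where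
  "M_MP vp vm \<phi> \<delta>p \<delta>m = (SUP (sp, sm)\<in>s_domain \<phi>. ereal (
     ((vp sp + 1) * \<phi> powr \<delta>p * (sm + 1) powr \<delta>p) /
     ((vm sm + 1) * (sp + 1) powr \<delta>m * (sp + 1 + \<phi> * (sm + 1)) powr (\<delta>p - \<delta>m))))"

definition k_MP :: "(real \<Rightarrow> real) \<Rightarrow> (real \<Rightarrow> real) \<Rightarrow> real \<Rightarrow> real \<Rightarrow> real \<Rightarrow> real \<Rightarrow>
    real \<Rightarrow> real \<Rightarrow> real" where
  "k_MP vp vm \<phi> \<delta>p \<delta>m lam sp sm = min
     (((\<delta>p * (vp sp + 1) * \<phi> powr \<delta>p * (sm + 1) powr \<delta>p) /
       (lam * \<delta>m * (vm sm + 1) * (sp + 1) powr \<delta>p)) powr (1 / (\<delta>m - \<delta>p)))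
     ((sp + 1) / (sp + 1 + \<phi> * (sm + 1)))"

end

theory Submission
  imports Defs "HOL-Real_Asymp.Real_Asymp"
begin

text \<open>
  The linear constraint determines \<open>z\<^sub>+\<close> from \<open>y = z\<^sub>-\<close>, and turns \<open>z\<^sub>+ + z\<^sub>- \<le> 1\<close> into
  \<open>y \<le> (s\<^sub>+ + 1) / (s\<^sub>+ + 1 + \<phi> (s\<^sub>- + 1))\<close>; so for given \<open>s\<^sub>+, s\<^sub>-\<close> it remains to maximize the difference
  of powers \<open>f\<close> over an interval, where a positive maximum has exactly one maximizer. The remaining
  point is that an optimum exists as soon as some feasible value is positive. The functions \<open>v\<^sub>+\<^sup>*\<close>
  and \<open>v\<^sub>-\<^sup>*\<close> are locally Hoelder continuous, \<open>v\<^sub>+\<^sup>*(s) = o(s powr \<delta>\<^sub>+)\<close> as \<open>s \<rightarrow> \<infinity>\<close>, and \<open>v\<^sub>-\<^sup>*(s)\<close>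
  tends to infinity as \<open>s \<rightarrow> \<phi> / (1 - \<phi>)\<close>. Hence points with at least a given positive value lie in
  a compact set on which the objective is continuous.
\<close>

section \<open>The value functions\<close>

text \<open>After division by \<open>a + b\<close> both arguments lie in the unit interval, where
  \<open>x \<le> x powr \<delta>\<close>, and they add up to 1.\<close>

lemma powr_add_le_add_powr:
  fixes a b \<delta> :: real
  assumes "0 \<le> a" "0 \<le> b" "0 \<le> \<delta>" "\<delta> \<le> 1"
  shows "(a + b) powr \<delta> \<le> a powr \<delta> + b powr \<delta>"
proof (cases "a + b = 0")
  case False
  define c where "c = a + b"
  have c: "c > 0" using False assms by (auto simp: c_def)
  have ge: "x / c \<le> (x / c) powr \<delta>" if "0 \<le> x" "x \<le> c" for x
    using powr_mono'[of \<delta> 1 "x / c"] that c assms by simp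
  have "1 = a / c + b / c" using c by (simp add: c_def add_divide_distrib[symmetric])
  also have "\<dots> \<le> (a / c) powr \<delta> + (b / c) powr \<delta>"
    using ge[of a] ge[of b] assms by (auto simp: c_def)
  also have "\<dots> = (a powr \<delta> + b powr \<delta>) / c powr \<delta>"
    using c assms by (simp add: powr_divide add_divide_distrib)
  finally show ?thesis using c by (simp add: c_def field_simps)
qed (use assms in auto)

text \<open>For exponents between 0 and 1, later estimates use only that these weights are
  nonnegative, at most 1 and telescoping.\<close>

definition powr_incr :: "real \<Rightarrow> nat \<Rightarrow> real" where
  "powr_incr \<alpha> n = real (Suc n + 1) powr \<alpha> - real (Suc n) powr \<alpha>"

lemma powr_incr_nonneg: "0 \<le> \<alpha> \<Longrightarrow> 0 \<le> powr_incr \<alpha> n"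
  by (simp add: powr_incr_def powr_mono2)

lemma powr_incr_le_1: "0 \<le> \<alpha> \<Longrightarrow> \<alpha> \<le> 1 \<Longrightarrow> powr_incr \<alpha> n \<le> 1"
  using powr_add_le_add_powr[of "real (Suc n)" 1 \<alpha>] by (simp add: powr_incr_def add_ac)

lemma sum_powr_incr: "(\<Sum>n<N. powr_incr \<alpha> n) = real (Suc N) powr \<alpha> - 1"
  by (induction N) (auto simp: powr_incr_def add_ac)

lemma value_series_powr_incr:
  "value_series \<alpha> \<delta> z = (\<Sum>n. ennreal (powr_incr \<alpha> n * z (Suc n) powr \<delta>))"
  by (simp add: value_series_def powr_incr_def)

lemma unit_decreasingD:
  assumes "unit_decreasing z"
  shows "0 \<le> z (Suc n)" "z (Suc n) \<le> 1" "z (Suc (Suc n)) \<le> z (Suc n)"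
  using assms by (auto simp: unit_decreasing_def)

lemma value_series_mono:
  assumes "0 \<le> \<alpha>" "0 \<le> \<delta>" "unit_decreasing z" "\<And>n. z (Suc n) \<le> w (Suc n)"
  shows "value_series \<alpha> \<delta> z \<le> value_series \<alpha> \<delta> w"
  unfolding value_series_powr_incr
  by (intro suminf_le ennreal_leI mult_left_mono powr_mono2 powr_incr_nonneg)
     (use assms in \<open>auto simp: unit_decreasingD\<close>)

lemma unit_decreasing_scale:
  assumes "unit_decreasing z" "0 \<le> c" "c \<le> 1"
  shows "unit_decreasing (\<lambda>n. c * z n)"
  using assms unfolding unit_decreasing_def
  by (auto intro: mult_left_mono mult_le_one)

lemma sums_scale:
  fixes z :: "nat \<Rightarrow> real"
  assumes "(\<lambda>n. x ^ Suc n * z (Suc n)) sums s"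
  shows "(\<lambda>n. x ^ Suc n * (c * z (Suc n))) sums (c * s)"
  using sums_mult[OF assms, of c] by (simp add: mult_ac)

text \<open>The weighted sum of a sequence is raised from \<open>s\<close> to \<open>t\<close> by moving its first \<open>N\<close> terms
  towards \<open>1\<close>.\<close>

lemma unit_decreasing_raise:
  fixes x s t \<eta> :: real
  assumes x: "0 < x" and z: "unit_decreasing z" "(\<lambda>n. x ^ Suc n * z (Suc n)) sums s"
    and st: "s \<le> t" and \<eta>: "0 < \<eta>" "t + \<eta> \<le> (\<Sum>n<N. x ^ Suc n)"
  obtains w where "unit_decreasing w" "(\<lambda>n. x ^ Suc n * w (Suc n)) sums t"
    "\<And>n. z (Suc n) \<le> w (Suc n)"
    "\<And>n. w (Suc n) \<le> z (Suc n) + (if n < N then (t - s) / \<eta> else 0)"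
proof -
  note z01 = unit_decreasingD[OF z(1)]
  \<comment> \<open>\<open>E\<close> is the weighted room left below 1 in the first \<open>N\<close>
    terms; closing the fraction \<open>\<theta>\<close> of each gap adds
    \<open>\<theta> * E = t - s\<close>.\<close>
  define E where "E = (\<Sum>n<N. x ^ Suc n * (1 - z (Suc n)))"
  define \<theta> where "\<theta> = (t - s) / E"
  \<comment> \<open>Indices start at 1, so \<open>n \<le> N\<close> here matches
    \<open>n < N\<close> for the terms \<open>w (Suc n)\<close>.\<close>
  define w where "w = (\<lambda>n. if n \<le> N then z n + \<theta> * (1 - z n) else z n)"
  have "(\<Sum>n<N. x ^ Suc n * z (Suc n)) \<le> s"
    using z(2) x z01 sum_le_suminf[of "\<lambda>n. x ^ Suc n * z (Suc n)" "{..<N}"] by (auto simp: sums_iff)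
  then have E: "t - s + \<eta> \<le> E"
    using \<eta>(2) by (simp add: E_def algebra_simps sum_subtractf)
  have \<theta>: "0 \<le> \<theta>" "\<theta> \<le> 1" "\<theta> \<le> (t - s) / \<eta>"
    using E st \<eta>(1) by (auto simp: \<theta>_def intro!: frac_le)
  show ?thesis
  proof
    show "z (Suc n) \<le> w (Suc n)" for n
      using z01[of n] \<theta> by (auto simp: w_def)
    show "w (Suc n) \<le> z (Suc n) + (if n < N then (t - s) / \<eta> else 0)" for n
    proof -
      have "\<theta> * (1 - z (Suc n)) \<le> \<theta> * 1"
        using z01[of n] \<theta> by (intro mult_left_mono) auto
      then show ?thesis using \<theta> by (auto simp: w_def)
    qed
    show "unit_decreasing w"
      unfolding unit_decreasing_def
    proof (intro allI impI)
      fix n :: nat assume "1 \<le> n"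
      then obtain m where n: "n = Suc m" by (cases n) auto
      have *: "z n + \<theta> * (1 - z n) \<le> 1" if "z n \<le> 1" for n
        using mult_right_mono[of \<theta> 1 "1 - z n"] \<theta> that by simp
      \<comment> \<open>A raised term is \<open>(1 - \<theta>) * z n + \<theta>\<close>,
        nondecreasing in \<open>z n\<close>; this handles \<open>n < N\<close>. At
        \<open>n = N\<close> the unchanged \<open>z (Suc N)\<close> lies below \<open>z N\<close>,
        hence below the raised value.\<close>
      have "(1 - \<theta>) * z (Suc n) \<le> (1 - \<theta>) * z n"
        using z01[of m] \<theta> n by (intro mult_left_mono) auto
      moreover have "0 \<le> \<theta> * (1 - z (Suc m))"
        using z01[of m] \<theta> by simp
      ultimately show "0 \<le> w n \<and> w n \<le> 1 \<and> w (Suc n) \<le> w n"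
        using z01[of m] \<theta> *[of n] n by (auto simp: w_def algebra_simps)
    qed
    have "(\<lambda>n. if n \<in> {..<N} then \<theta> * (x ^ Suc n * (1 - z (Suc n))) else 0) sums (\<Sum>n<N. \<theta> * (x ^ Suc n * (1 - z (Suc n))))"
      by (intro sums_If_finite_set) auto
    from sums_add[OF z(2) this]
    have "(\<lambda>n. x ^ Suc n * z (Suc n) +
            (if n \<in> {..<N} then \<theta> * (x ^ Suc n * (1 - z (Suc n))) else 0)) sums (s + \<theta> * E)"
      by (simp only: E_def sum_distrib_left)
    also have "(\<lambda>n. x ^ Suc n * z (Suc n) +
            (if n \<in> {..<N} then \<theta> * (x ^ Suc n * (1 - z (Suc n))) else 0)) =
          (\<lambda>n. x ^ Suc n * w (Suc n))"
      by (auto simp: w_def algebra_simps)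
    finally have "(\<lambda>n. x ^ Suc n * w (Suc n)) sums (s + \<theta> * E)" .
    then show "(\<lambda>n. x ^ Suc n * w (Suc n)) sums t"
      using E st \<eta>(1) by (simp add: \<theta>_def)
  qed
qed

text \<open>Monotonicity turns the one-sided estimate into one for the distance, which tends to 0
  since \<open>\<delta>\<close> is positive. Applied to both value functions.\<close>

lemma continuous_on_of_Hoelder:
  fixes g :: "real \<Rightarrow> real"
  assumes "0 < \<delta>"
    and mono: "\<And>s t. s \<in> D \<Longrightarrow> t \<in> D \<Longrightarrow> s \<le> t \<Longrightarrow> g s \<le> g t"
    and le: "\<And>s t. s \<in> D \<Longrightarrow> t \<in> D \<Longrightarrow> s \<le> t \<Longrightarrow> g t \<le> g s + C * (t - s) powr \<delta>"
  shows "continuous_on D g"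
  unfolding continuous_on_def
proof
  fix x assume x: "x \<in> D"
  have "dist (g y) (g x) \<le> C * \<bar>y - x\<bar> powr \<delta>" if "y \<in> D" for y
    using mono[OF x that] mono[OF that x] le[OF x that] le[OF that x]
    by (cases "x \<le> y") (auto simp: dist_real_def abs_if)
  then have "\<forall>\<^sub>F y in at x within D. dist (g y) (g x) \<le> C * \<bar>y - x\<bar> powr \<delta>"
    by (simp add: eventually_at_filter)
  moreover have "((\<lambda>y. C * \<bar>y - x\<bar> powr \<delta>) \<longlongrightarrow> C * \<bar>x - x\<bar> powr \<delta>) (at x within D)"
    by (intro tendsto_intros tendsto_powr') (use assms(1) in auto)
  then have "((\<lambda>y. C * \<bar>y - x\<bar> powr \<delta>) \<longlongrightarrow> 0) (at x within D)"
    by simp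
  ultimately show "(g \<longlongrightarrow> g x) (at x within D)"
    unfolding tendsto_dist_iff[of g]
    by (rule tendsto_sandwich[OF always_eventually _ tendsto_const, rotated]) simp
qed

text \<open>For gains \<open>e\<close> lists the summands of a second value series; for losses it is
  the cost of changing finitely many terms.\<close>

lemma value_series_le_add:
  assumes "0 \<le> \<alpha>" "\<And>n. 0 \<le> e n"
    and "\<And>n. powr_incr \<alpha> n * w (Suc n) powr \<delta> \<le> powr_incr \<alpha> n * z (Suc n) powr \<delta> + e n"
  shows "value_series \<alpha> \<delta> w \<le> value_series \<alpha> \<delta> z + (\<Sum>n. ennreal (e n))"
proof -
  have "value_series \<alpha> \<delta> w \<le>
      (\<Sum>n. ennreal (powr_incr \<alpha> n * z (Suc n) powr \<delta>) + ennreal (e n))"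
    unfolding value_series_powr_incr
    by (intro suminf_le) (use assms in \<open>auto simp: powr_incr_nonneg simp flip: ennreal_plus intro!: ennreal_leI\<close>)
  then show ?thesis
    by (simp add: value_series_powr_incr suminf_add)
qed

subsection \<open>Gains\<close>

text \<open>The sum over all \<open>n\<close> of \<open>(1 / \<rho> powr \<epsilon>) ^ Suc n\<close>
  when \<open>\<rho> powr \<epsilon>\<close> exceeds 1.\<close>

definition gain_const :: "real \<Rightarrow> real \<Rightarrow> real" where
  "gain_const \<rho> \<epsilon> = 1 / (\<rho> powr \<epsilon> - 1)"

text \<open>Since \<open>z \<le> 1\<close>, the exponent \<open>\<delta>\<close> can be lowered to \<open>\<epsilon>\<close>; choosing \<open>\<epsilon> < \<delta>\<close> gives growth
  slower than \<open>s powr \<delta>\<close>.\<close>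

lemma value_series_le_gain:
  assumes \<rho>: "1 < \<rho>" and \<alpha>: "0 \<le> \<alpha>" "\<alpha> \<le> 1" and \<epsilon>: "0 < \<epsilon>" "\<epsilon> \<le> \<delta>"
    and z: "z \<in> plus_feasible \<rho> s"
  shows "value_series \<alpha> \<delta> z \<le> ennreal (gain_const \<rho> \<epsilon> * s powr \<epsilon>)"
proof -
  define r where "r = 1 / \<rho> powr \<epsilon>"
  have \<rho>\<epsilon>: "1 < \<rho> powr \<epsilon>"
    using \<rho> \<epsilon> by (simp add: gr_one_powr)
  have r: "0 < r" "r < 1" using \<rho>\<epsilon> \<rho> by (auto simp: r_def)
  have z: "unit_decreasing z" "(\<lambda>n. \<rho> ^ Suc n * z (Suc n)) sums s"
    using z by (auto simp: plus_feasible_def)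
  note z01 = unit_decreasingD[OF z(1)]
  \<comment> \<open>One term of a nonnegative series is at most the sum, so
    \<open>z (Suc n) \<le> s / \<rho> ^ Suc n\<close>; the power \<open>\<epsilon>\<close> of this
    bound is a geometric sequence.\<close>
  have summand: "powr_incr \<alpha> n * z (Suc n) powr \<delta> \<le> s powr \<epsilon> * r ^ Suc n" for n
  proof -
    have "\<rho> ^ Suc n * z (Suc n) \<le> s"
      using sum_le_suminf[of "\<lambda>n. \<rho> ^ Suc n * z (Suc n)" "{n}"] z(2) z01 \<rho> by (simp add: sums_iff)
    then have zs: "z (Suc n) \<le> s / \<rho> ^ Suc n" using \<rho> by (simp add: field_simps)
    then have s: "0 \<le> s / \<rho> ^ Suc n" using z01(1)[of n] by linarith
    then have s: "0 \<le> s" using \<rho> zero_less_power[of \<rho> "Suc n"] unfolding zero_le_divide_iff by linarith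
    have "powr_incr \<alpha> n * z (Suc n) powr \<delta> \<le> 1 * z (Suc n) powr \<delta>"
      using powr_incr_le_1[OF \<alpha>] by (intro mult_right_mono) auto
    also have "\<dots> \<le> z (Suc n) powr \<epsilon>"
      using z01 \<epsilon> by (simp add: powr_mono')
    also have "\<dots> \<le> (s / \<rho> ^ Suc n) powr \<epsilon>"
      using z01 zs \<epsilon> by (intro powr_mono2) auto
    also have "\<dots> = s powr \<epsilon> / (\<rho> ^ Suc n) powr \<epsilon>"
      by (rule powr_divide)
    also have "(\<rho> ^ Suc n) powr \<epsilon> = (\<rho> powr \<epsilon>) ^ Suc n"
      using \<rho> by (simp add: powr_powr mult.commute del: power_Suc flip: powr_realpow)
    finally show ?thesis by (simp add: r_def power_one_over)
  qed
  have "(\<lambda>n. s powr \<epsilon> * r * r ^ n) sums (s powr \<epsilon> * r * (1 / (1 - r)))"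
    using r by (intro sums_mult geometric_sums) auto
  moreover have "s powr \<epsilon> * r * (1 / (1 - r)) = gain_const \<rho> \<epsilon> * s powr \<epsilon>"
    using r \<rho>\<epsilon> by (simp add: gain_const_def r_def field_simps)
  ultimately have "(\<Sum>n. ennreal (s powr \<epsilon> * r ^ Suc n)) = ennreal (gain_const \<rho> \<epsilon> * s powr \<epsilon>)"
    using r by (intro suminf_ennreal_eq) (auto simp: mult_ac)
  moreover have "value_series \<alpha> \<delta> z \<le> (\<Sum>n. ennreal (s powr \<epsilon> * r ^ Suc n))"
    unfolding value_series_powr_incr by (intro suminf_le ennreal_leI summand) auto
  ultimately show ?thesis by simp
qed

lemma v_plus_le:
  assumes "1 < \<rho>" "0 \<le> \<alpha>" "\<alpha> \<le> 1" "0 < \<epsilon>" "\<epsilon> \<le> \<delta>"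
  shows "v_plus \<alpha> \<delta> \<rho> s \<le> gain_const \<rho> \<epsilon> * s powr \<epsilon>"
  unfolding v_plus_def
  using assms by (intro enn2real_leI SUP_least value_series_le_gain)
    (auto simp: gain_const_def ge_one_powr_ge_zero)

text \<open>The geometric bound with \<open>\<epsilon> = \<delta>\<close> makes the supremum
  finite.\<close>

lemma ennreal_v_plus:
  assumes "1 < \<rho>" "0 \<le> \<alpha>" "\<alpha> \<le> 1" "0 < \<delta>"
  shows "ennreal (v_plus \<alpha> \<delta> \<rho> s) = (SUP z\<in>plus_feasible \<rho> s. value_series \<alpha> \<delta> z)"
proof -
  have "(SUP z\<in>plus_feasible \<rho> s. value_series \<alpha> \<delta> z) \<le> ennreal (gain_const \<rho> \<delta> * s powr \<delta>)"
    using assms by (intro SUP_least value_series_le_gain) auto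
  then show ?thesis
    unfolding v_plus_def by (intro ennreal_enn2real) (auto simp: le_less_trans)
qed

lemma value_series_le_v_plus:
  assumes "1 < \<rho>" "0 \<le> \<alpha>" "\<alpha> \<le> 1" "0 < \<delta>" "z \<in> plus_feasible \<rho> s"
  shows "value_series \<alpha> \<delta> z \<le> ennreal (v_plus \<alpha> \<delta> \<rho> s)"
  using assms by (simp add: ennreal_v_plus SUP_upper)

lemma v_plus_leI:
  assumes "0 \<le> B" "\<And>z. z \<in> plus_feasible \<rho> s \<Longrightarrow> value_series \<alpha> \<delta> z \<le> ennreal B"
  shows "v_plus \<alpha> \<delta> \<rho> s \<le> B"
  unfolding v_plus_def using assms by (intro enn2real_leI SUP_least) auto

lemma v_plus_nonneg: "0 \<le> v_plus \<alpha> \<delta> \<rho> s"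
  by (simp add: v_plus_def)

text \<open>Scaling up could violate the bound 1, so a competitor for \<open>s\<close> is raised to
  one for \<open>t\<close> that dominates it termwise.\<close>

lemma v_plus_mono:
  assumes \<rho>: "1 < \<rho>" and \<alpha>: "0 \<le> \<alpha>" "\<alpha> \<le> 1" and \<delta>: "0 < \<delta>" and st: "s \<le> t"
  shows "v_plus \<alpha> \<delta> \<rho> s \<le> v_plus \<alpha> \<delta> \<rho> t"
proof (rule v_plus_leI[OF v_plus_nonneg])
  fix z assume "z \<in> plus_feasible \<rho> s"
  then have z: "unit_decreasing z" "(\<lambda>n. \<rho> ^ Suc n * z (Suc n)) sums s"
    by (auto simp: plus_feasible_def)
  \<comment> \<open>Every weight \<open>\<rho> ^ Suc n\<close> is at least 1, so the first
    \<open>N\<close> terms have room for \<open>t\<close> with slack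
    \<open>\<eta> = 1\<close>.\<close>
  obtain N :: nat where N: "t + 1 \<le> N" using real_arch_simple by blast
  have "(\<Sum>n<N. 1) \<le> (\<Sum>n<N. \<rho> ^ Suc n)"
    using \<rho> by (intro sum_mono one_le_power) auto
  then have weight: "t + 1 \<le> (\<Sum>n<N. \<rho> ^ Suc n)" using N by simp
  have "0 < \<rho>" using \<rho> by simp
  then obtain w where w: "unit_decreasing w" "(\<lambda>n. \<rho> ^ Suc n * w (Suc n)) sums t"
    "\<And>n. z (Suc n) \<le> w (Suc n)"
    using unit_decreasing_raise[OF _ z st zero_less_one weight] by metis
  have "value_series \<alpha> \<delta> z \<le> value_series \<alpha> \<delta> w"
    using w z \<alpha> \<delta> by (intro value_series_mono) auto
  also have "\<dots> \<le> ennreal (v_plus \<alpha> \<delta> \<rho> t)"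
    using w \<rho> \<alpha> \<delta> by (intro value_series_le_v_plus) (auto simp: plus_feasible_def)
  finally show "value_series \<alpha> \<delta> z \<le> ennreal (v_plus \<alpha> \<delta> \<rho> t)" .
qed

text \<open>A sequence of weight \<open>t\<close> is the sum of its multiples of weights \<open>s\<close> and \<open>t - s\<close>, and
  \<open>\<lambda>x. x powr \<delta>\<close> is subadditive.\<close>

lemma v_plus_le_add:
  assumes \<rho>: "1 < \<rho>" and \<alpha>: "0 \<le> \<alpha>" "\<alpha> \<le> 1" and \<delta>: "0 < \<delta>" "\<delta> \<le> 1" and st: "0 \<le> s" "s \<le> t"
  shows "v_plus \<alpha> \<delta> \<rho> t \<le> v_plus \<alpha> \<delta> \<rho> s + v_plus \<alpha> \<delta> \<rho> (t - s)"
proof (cases "t = 0")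
  case False
  then have t: "0 < t" using st by simp
  show ?thesis
  proof (rule v_plus_leI)
    fix z assume "z \<in> plus_feasible \<rho> t"
    then have z: "unit_decreasing z" "(\<lambda>n. \<rho> ^ Suc n * z (Suc n)) sums t"
      by (auto simp: plus_feasible_def)
    define c where "c = s / t"
    have c: "0 \<le> c" "c \<le> 1" using st t by (auto simp: c_def)
    have feas: "(\<lambda>n. c * z n) \<in> plus_feasible \<rho> s" "(\<lambda>n. (1 - c) * z n) \<in> plus_feasible \<rho> (t - s)"
      using unit_decreasing_scale[OF z(1), of c] unit_decreasing_scale[OF z(1), of "1 - c"] c t
        sums_scale[OF z(2), of c] sums_scale[OF z(2), of "1 - c"]
      by (auto simp: plus_feasible_def c_def left_diff_distrib)
    have "z (Suc n) powr \<delta> \<le> (c * z (Suc n)) powr \<delta> + ((1 - c) * z (Suc n)) powr \<delta>" for n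
      using powr_add_le_add_powr[of "c * z (Suc n)" "(1 - c) * z (Suc n)" \<delta>] c \<delta>
        unit_decreasingD(1)[OF z(1), of n] by (simp add: left_diff_distrib mult_left_le_one_le)
    then have "powr_incr \<alpha> n * z (Suc n) powr \<delta> \<le> powr_incr \<alpha> n * (c * z (Suc n)) powr \<delta>
        + powr_incr \<alpha> n * ((1 - c) * z (Suc n)) powr \<delta>" for n
      using powr_incr_nonneg[OF \<alpha>(1)] by (metis distrib_left mult_left_mono)
    then have "value_series \<alpha> \<delta> z \<le>
        value_series \<alpha> \<delta> (\<lambda>n. c * z n) + value_series \<alpha> \<delta> (\<lambda>n. (1 - c) * z n)"
      using \<alpha> powr_incr_nonneg[OF \<alpha>(1)]
      unfolding value_series_powr_incr[of _ _ "\<lambda>n. (1 - c) * z n"]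
      by (intro value_series_le_add) auto
    also have "\<dots> \<le> ennreal (v_plus \<alpha> \<delta> \<rho> s) + ennreal (v_plus \<alpha> \<delta> \<rho> (t - s))"
      using \<rho> \<alpha> \<delta> feas by (intro add_mono value_series_le_v_plus) auto
    finally show "value_series \<alpha> \<delta> z \<le> ennreal (v_plus \<alpha> \<delta> \<rho> s + v_plus \<alpha> \<delta> \<rho> (t - s))"
      by (simp add: v_plus_nonneg)
  qed (simp add: v_plus_nonneg)
qed (use st v_plus_nonneg in auto)

lemma continuous_on_v_plus:
  assumes "1 < \<rho>" "0 \<le> \<alpha>" "\<alpha> \<le> 1" "0 < \<delta>" "\<delta> \<le> 1"
  shows "continuous_on {0..} (v_plus \<alpha> \<delta> \<rho>)"
proof (rule continuous_on_of_Hoelder)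
  fix s t :: real assume st: "s \<in> {0..}" "t \<in> {0..}" "s \<le> t"
  show "v_plus \<alpha> \<delta> \<rho> s \<le> v_plus \<alpha> \<delta> \<rho> t"
    using assms st by (intro v_plus_mono) auto
  show "v_plus \<alpha> \<delta> \<rho> t \<le> v_plus \<alpha> \<delta> \<rho> s + gain_const \<rho> \<delta> * (t - s) powr \<delta>"
    using v_plus_le_add[OF assms, of s t] v_plus_le[OF assms(1-3), of \<delta> \<delta> "t - s"] assms st by auto
qed (use assms in auto)

text \<open>The growth bound is applied with exponent \<open>\<delta> / 2\<close>, so the
  denominator dominates.\<close>

lemma v_plus_tendsto:
  assumes "1 < \<rho>" "0 \<le> \<alpha>" "\<alpha> \<le> 1" "0 < \<delta>"
  shows "((\<lambda>s. (v_plus \<alpha> \<delta> \<rho> s + 1) / (s + 1) powr \<delta>) \<longlongrightarrow> 0) at_top"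
proof (rule tendsto_sandwich[OF always_eventually _ tendsto_const])
  show "\<forall>s. 0 \<le> (v_plus \<alpha> \<delta> \<rho> s + 1) / (s + 1) powr \<delta>"
    by (simp add: v_plus_nonneg)
  show "\<forall>\<^sub>F s in at_top. (v_plus \<alpha> \<delta> \<rho> s + 1) / (s + 1) powr \<delta>
      \<le> (gain_const \<rho> (\<delta> / 2) * s powr (\<delta> / 2) + 1) / (s + 1) powr \<delta>"
    using v_plus_le[OF assms(1-3), of "\<delta> / 2" \<delta>] assms(4)
    by (intro always_eventually allI divide_right_mono add_right_mono) auto
  show "((\<lambda>s. (gain_const \<rho> (\<delta> / 2) * s powr (\<delta> / 2) + 1) / (s + 1) powr \<delta>) \<longlongrightarrow> 0) at_top"
    using assms(4) by real_asymp
qed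

subsection \<open>Losses\<close>

lemma minus_weight_total:
  fixes \<phi> :: real
  assumes "0 < \<phi>" "\<phi> < 1"
  shows "(\<lambda>n. \<phi> ^ Suc n) sums (\<phi> / (1 - \<phi>))"
  using sums_mult[OF geometric_sums[of \<phi>], of \<phi>] assms by simp

text \<open>Supplies the \<open>N\<close> and the slack \<open>\<eta>\<close> for raising sequences:
  the partial sums of the weights converge to a limit beyond \<open>b\<close>.\<close>

lemma minus_partial_sum:
  fixes \<phi> :: real
  assumes "0 < \<phi>" "\<phi> < 1" "b < \<phi> / (1 - \<phi>)"
  obtains N \<eta> where "0 < \<eta>" "b + \<eta> \<le> (\<Sum>n<N. \<phi> ^ Suc n)"
proof -
  have "\<forall>\<^sub>F N in sequentially. b < (\<Sum>n<N. \<phi> ^ Suc n)"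
    using minus_weight_total[OF assms(1,2)] assms(3) unfolding sums_def by (rule order_tendstoD)
  then obtain N where "b < (\<Sum>n<N. \<phi> ^ Suc n)"
    by (auto simp: eventually_sequentially)
  then show ?thesis using that[of "(\<Sum>n<N. \<phi> ^ Suc n) - b" N] by simp
qed

text \<open>The infimum before conversion to reals; its finiteness is itself a consequence of the
  estimates below.\<close>

abbreviation v_minus_ennreal :: "real \<Rightarrow> real \<Rightarrow> real \<Rightarrow> real \<Rightarrow> ennreal" where
  "v_minus_ennreal \<alpha> \<delta> \<phi> s \<equiv> (INF z\<in>minus_feasible \<phi> s. value_series \<alpha> \<delta> z)"

text \<open>Unlike for gains, scaling by \<open>s / t\<close> suffices: it makes a competitor for
  \<open>t\<close> feasible for \<open>s\<close> without increasing its value.\<close>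

lemma v_minus_ennreal_mono:
  assumes \<alpha>: "0 \<le> \<alpha>" and \<delta>: "0 \<le> \<delta>" and st: "0 \<le> s" "s \<le> t"
  shows "v_minus_ennreal \<alpha> \<delta> \<phi> s \<le> v_minus_ennreal \<alpha> \<delta> \<phi> t"
proof (cases "t = 0")
  case False
  then have t: "0 < t" using st by simp
  show ?thesis
  proof (rule INF_greatest)
    fix z assume "z \<in> minus_feasible \<phi> t"
    then have z: "unit_decreasing z" "summable (\<lambda>n. z (Suc n))" "(\<lambda>n. \<phi> ^ Suc n * z (Suc n)) sums t"
      by (auto simp: minus_feasible_def)
    define c where "c = s / t"
    have c: "0 \<le> c" "c \<le> 1" using st t by (auto simp: c_def)
    have ud: "unit_decreasing (\<lambda>n. c * z n)"
      by (rule unit_decreasing_scale[OF z(1) c])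
    then have "(\<lambda>n. c * z n) \<in> minus_feasible \<phi> s"
      using summable_mult[OF z(2), of c] sums_scale[OF z(3), of c] t
      by (auto simp: minus_feasible_def c_def)
    moreover have "value_series \<alpha> \<delta> (\<lambda>n. c * z n) \<le> value_series \<alpha> \<delta> z"
      using ud unit_decreasingD(1)[OF z(1)] c \<alpha> \<delta>
      by (intro value_series_mono) (auto intro: mult_left_le_one_le)
    ultimately show "v_minus_ennreal \<alpha> \<delta> \<phi> s \<le> value_series \<alpha> \<delta> z"
      by (rule order_trans[OF INF_lower[of _ _ "value_series \<alpha> \<delta>"]])
  qed
qed (use st in simp)

text \<open>Raising a competitor for \<open>s\<close> to weight \<open>t\<close> changes only the
  first \<open>N\<close> terms, each by at most \<open>(t - s) / \<eta>\<close>. Subadditivity of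
  powers and weights at most 1 bound the extra cost.\<close>

lemma v_minus_ennreal_le_add:
  assumes \<phi>: "0 < \<phi>" and \<alpha>: "0 \<le> \<alpha>" "\<alpha> \<le> 1" and \<delta>: "0 < \<delta>" "\<delta> \<le> 1"
    and st: "0 \<le> s" "s \<le> t" and \<eta>: "0 < \<eta>" "t + \<eta> \<le> (\<Sum>n<N. \<phi> ^ Suc n)"
  shows "v_minus_ennreal \<alpha> \<delta> \<phi> t \<le> v_minus_ennreal \<alpha> \<delta> \<phi> s + ennreal (real N * ((t - s) / \<eta>) powr \<delta>)"
proof -
  define \<theta> where "\<theta> = (t - s) / \<eta>"
  define e where "e = (\<lambda>n. if n < N then \<theta> powr \<delta> else 0)"
  have \<theta>: "0 \<le> \<theta>" using st \<eta> by (simp add: \<theta>_def)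
  have e: "(\<Sum>n. ennreal (e n)) = ennreal (real N * \<theta> powr \<delta>)"
    using sums_If_finite_set[of "{..<N}" "\<lambda>_. \<theta> powr \<delta>"]
    by (intro suminf_ennreal_eq) (auto simp: e_def)
  have "v_minus_ennreal \<alpha> \<delta> \<phi> t \<le> value_series \<alpha> \<delta> z + ennreal (real N * \<theta> powr \<delta>)"
    if "z \<in> minus_feasible \<phi> s" for z
  proof -
    have z: "unit_decreasing z" "summable (\<lambda>n. z (Suc n))" "(\<lambda>n. \<phi> ^ Suc n * z (Suc n)) sums s"
      using that by (auto simp: minus_feasible_def)
    obtain w where w: "unit_decreasing w" "(\<lambda>n. \<phi> ^ Suc n * w (Suc n)) sums t"
      "\<And>n. w (Suc n) \<le> z (Suc n) + (if n < N then \<theta> else 0)"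
      unfolding \<theta>_def using unit_decreasing_raise[OF \<phi> z(1,3) st(2) \<eta>] by metis
    note w01 = unit_decreasingD[OF w(1)] and z01 = unit_decreasingD[OF z(1)]
    \<comment> \<open>A finitely supported change keeps the summability demanded by
      \<open>minus_feasible\<close>.\<close>
    have "summable (\<lambda>n. z (Suc n) + (if n < N then \<theta> else 0))"
      using sums_If_finite_set[of "{..<N}" "\<lambda>_. \<theta>"] z(2)
      by (intro summable_add) (auto simp: sums_iff)
    then have "summable (\<lambda>n. w (Suc n))"
      by (rule summable_comparison_test') (use w(3) w01 in auto)
    then have "v_minus_ennreal \<alpha> \<delta> \<phi> t \<le> value_series \<alpha> \<delta> w"
      using w by (intro INF_lower) (auto simp: minus_feasible_def)
    also have "\<dots> \<le> value_series \<alpha> \<delta> z + (\<Sum>n. ennreal (e n))"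
    proof (rule value_series_le_add[OF \<alpha>(1)])
      fix n
      have "w (Suc n) powr \<delta> \<le> (z (Suc n) + (if n < N then \<theta> else 0)) powr \<delta>"
        using w(3) w01 \<delta> by (intro powr_mono2) auto
      also have "\<dots> \<le> z (Suc n) powr \<delta> + e n"
        using powr_add_le_add_powr[of "z (Suc n)" \<theta> \<delta>] z01 \<theta> \<delta> by (auto simp: e_def)
      finally have "powr_incr \<alpha> n * w (Suc n) powr \<delta> \<le> powr_incr \<alpha> n * (z (Suc n) powr \<delta> + e n)"
        using powr_incr_nonneg[OF \<alpha>(1)] by (intro mult_left_mono)
      also have "\<dots> \<le> powr_incr \<alpha> n * z (Suc n) powr \<delta> + 1 * e n"
        using powr_incr_le_1[OF \<alpha>, of n] unfolding distrib_left
        by (intro add_mono mult_right_mono) (auto simp: e_def)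
      finally show "powr_incr \<alpha> n * w (Suc n) powr \<delta> \<le> powr_incr \<alpha> n * z (Suc n) powr \<delta> + e n"
        by simp
    qed (simp add: e_def)
    finally show ?thesis by (simp add: e)
  qed
  \<comment> \<open>The added constant is moved to the left so that the bound, valid for each
    \<open>z\<close>, passes to the infimum.\<close>
  then have "v_minus_ennreal \<alpha> \<delta> \<phi> t - ennreal (real N * \<theta> powr \<delta>) \<le> v_minus_ennreal \<alpha> \<delta> \<phi> s"
    by (intro INF_greatest) (simp add: ennreal_minus_le_iff add.commute)
  then show ?thesis
    by (simp add: ennreal_minus_le_iff \<theta>_def add.commute)
qed

lemma v_minus_ennreal_0: "v_minus_ennreal \<alpha> \<delta> \<phi> 0 = 0"
proof -
  have "(\<lambda>_. 0) \<in> minus_feasible \<phi> 0"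
    by (simp add: minus_feasible_def unit_decreasing_def)
  from INF_lower[OF this, of "value_series \<alpha> \<delta>"] show ?thesis
    by (simp add: value_series_def)
qed

text \<open>Comparison with weight 0, whose infimum is 0, shows finiteness.\<close>

lemma ennreal_v_minus:
  assumes "0 < \<phi>" "\<phi> < 1" "0 \<le> \<alpha>" "\<alpha> \<le> 1" "0 < \<delta>" "\<delta> \<le> 1" "0 \<le> s" "s < \<phi> / (1 - \<phi>)"
  shows "ennreal (v_minus \<alpha> \<delta> \<phi> s) = v_minus_ennreal \<alpha> \<delta> \<phi> s"
proof -
  obtain N \<eta> where N: "0 < \<eta>" "s + \<eta> \<le> (\<Sum>n<N. \<phi> ^ Suc n)"
    using minus_partial_sum[OF assms(1,2,8)] .
  have "v_minus_ennreal \<alpha> \<delta> \<phi> s \<le> v_minus_ennreal \<alpha> \<delta> \<phi> 0 + ennreal (real N * ((s - 0) / \<eta>) powr \<delta>)"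
    by (rule v_minus_ennreal_le_add) (use assms N in auto)
  then show ?thesis
    unfolding v_minus_def v_minus_ennreal_0 by (intro ennreal_enn2real) (auto simp: le_less_trans)
qed

lemma v_minus_nonneg: "0 \<le> v_minus \<alpha> \<delta> \<phi> s"
  by (simp add: v_minus_def)

text \<open>\<open>N\<close> and \<open>\<eta>\<close> chosen for \<open>b\<close> serve every
  \<open>t \<le> b\<close>, which gives one Hoelder constant on \<open>{0..b}\<close>.\<close>

lemma continuous_on_v_minus:
  assumes "0 < \<phi>" "\<phi> < 1" "0 \<le> \<alpha>" "\<alpha> \<le> 1" "0 < \<delta>" "\<delta> \<le> 1" and b: "b < \<phi> / (1 - \<phi>)"
  shows "continuous_on {0..b} (v_minus \<alpha> \<delta> \<phi>)"
proof -
  obtain N \<eta> where N: "0 < \<eta>" "b + \<eta> \<le> (\<Sum>n<N. \<phi> ^ Suc n)"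
    using minus_partial_sum[OF assms(1,2,7)] .
  show ?thesis
  proof (rule continuous_on_of_Hoelder)
    fix s t :: real assume "s \<in> {0..b}" "t \<in> {0..b}" and st: "s \<le> t"
    then have D: "0 \<le> s" "0 \<le> t" "s < \<phi> / (1 - \<phi>)" "t < \<phi> / (1 - \<phi>)" "t + \<eta> \<le> (\<Sum>n<N. \<phi> ^ Suc n)"
      using b N by auto
    note e = ennreal_v_minus[OF assms(1-6) D(1,3)] ennreal_v_minus[OF assms(1-6) D(2,4)]
    show "v_minus \<alpha> \<delta> \<phi> s \<le> v_minus \<alpha> \<delta> \<phi> t"
      using v_minus_ennreal_mono[of \<alpha> \<delta> s t \<phi>] assms D st
      by (simp flip: e add: ennreal_le_iff v_minus_nonneg)
    have "ennreal (v_minus \<alpha> \<delta> \<phi> t)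
        \<le> ennreal (v_minus \<alpha> \<delta> \<phi> s) + ennreal (real N * ((t - s) / \<eta>) powr \<delta>)"
      unfolding e by (rule v_minus_ennreal_le_add) (use assms D st N in auto)
    then have "v_minus \<alpha> \<delta> \<phi> t \<le> v_minus \<alpha> \<delta> \<phi> s + real N * ((t - s) / \<eta>) powr \<delta>"
      by (simp add: ennreal_le_iff v_minus_nonneg flip: ennreal_plus)
    then show "v_minus \<alpha> \<delta> \<phi> t \<le> v_minus \<alpha> \<delta> \<phi> s + (real N / \<eta> powr \<delta>) * (t - s) powr \<delta>"
      using st N by (simp add: powr_divide)
  qed (use assms in auto)
qed

text \<open>As \<open>s\<close> approaches the total weight, the first \<open>N\<close> terms of a feasible sequence are forced
  to be at least \<open>1/2\<close>.\<close>

lemma v_minus_ge: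
  assumes \<phi>: "0 < \<phi>" "\<phi> < 1" and \<alpha>: "0 \<le> \<alpha>" "\<alpha> \<le> 1" and \<delta>: "0 < \<delta>" "\<delta> \<le> 1"
    and s: "0 \<le> s" "s < \<phi> / (1 - \<phi>)" "\<phi> / (1 - \<phi>) - \<phi> ^ N / 2 \<le> s"
  shows "(real (Suc N) powr \<alpha> - 1) / 2 \<le> v_minus \<alpha> \<delta> \<phi> s"
proof -
  have "ennreal ((real (Suc N) powr \<alpha> - 1) / 2) \<le> value_series \<alpha> \<delta> z" if "z \<in> minus_feasible \<phi> s" for z
  proof -
    have z: "unit_decreasing z" "(\<lambda>n. \<phi> ^ Suc n * z (Suc n)) sums s"
      using that by (auto simp: minus_feasible_def)
    note z01 = unit_decreasingD[OF z(1)]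
    \<comment> \<open>The missing weight \<open>\<phi> / (1 - \<phi>) - s\<close> is a sum of
      nonnegative gaps, so it bounds each one.\<close>
    have gap: "(\<lambda>n. \<phi> ^ Suc n * (1 - z (Suc n))) sums (\<phi> / (1 - \<phi>) - s)"
      using sums_diff[OF minus_weight_total[OF \<phi>] z(2)] by (simp add: algebra_simps)
    have half: "1 / 2 \<le> z (Suc n) powr \<delta>" if "n < N" for n
    proof -
      have "\<phi> ^ Suc n * (1 - z (Suc n)) \<le> \<phi> / (1 - \<phi>) - s"
        using sum_le_suminf[of "\<lambda>n. \<phi> ^ Suc n * (1 - z (Suc n))" "{n}"] gap z01 \<phi>
        by (simp add: sums_iff)
      also have "\<dots> \<le> \<phi> ^ N / 2" using s(3) by linarith
      also have "\<phi> ^ N \<le> \<phi> ^ Suc n" using that \<phi> by (intro power_decreasing) auto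
      finally have "\<phi> ^ Suc n * (1 - z (Suc n)) \<le> \<phi> ^ Suc n * (1 / 2)" by simp
      then have "1 - z (Suc n) \<le> 1 / 2"
        using \<phi> by (subst (asm) mult_le_cancel_left_pos) auto
      moreover have "z (Suc n) \<le> z (Suc n) powr \<delta>"
        using powr_mono'[of \<delta> 1 "z (Suc n)"] z01 \<delta> by simp
      ultimately show ?thesis by linarith
    qed
    \<comment> \<open>With 1/2 in place of each power the sum telescopes.\<close>
    have "ennreal ((real (Suc N) powr \<alpha> - 1) / 2) = ennreal (\<Sum>n<N. powr_incr \<alpha> n * (1 / 2))"
      by (simp only: sum_powr_incr flip: sum_distrib_right) simp
    also have "\<dots> \<le> ennreal (\<Sum>n<N. powr_incr \<alpha> n * z (Suc n) powr \<delta>)"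
      using half powr_incr_nonneg[OF \<alpha>(1)] by (intro ennreal_leI sum_mono mult_left_mono) auto
    also have "\<dots> = (\<Sum>n<N. ennreal (powr_incr \<alpha> n * z (Suc n) powr \<delta>))"
      using powr_incr_nonneg[OF \<alpha>(1)] by (intro sum_ennreal[symmetric]) auto
    also have "\<dots> \<le> value_series \<alpha> \<delta> z"
      unfolding value_series_powr_incr by (rule sum_le_suminf) auto
    finally show ?thesis .
  qed
  then have "ennreal ((real (Suc N) powr \<alpha> - 1) / 2) \<le> ennreal (v_minus \<alpha> \<delta> \<phi> s)"
    unfolding ennreal_v_minus[OF \<phi> \<alpha> \<delta> s(1,2)] by (rule INF_greatest)
  then show ?thesis by (simp add: ennreal_le_iff v_minus_nonneg)
qed

lemma filterlim_v_minus:
  assumes \<phi>: "0 < \<phi>" "\<phi> < 1" and \<alpha>: "0 < \<alpha>" "\<alpha> \<le> 1" and \<delta>: "0 < \<delta>" "\<delta> \<le> 1"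
  shows "filterlim (v_minus \<alpha> \<delta> \<phi>) at_top (at_left (\<phi> / (1 - \<phi>)))"
  unfolding filterlim_at_top
proof
  fix K :: real
  have "filterlim (\<lambda>N. (real (Suc N) powr \<alpha> - 1) / 2) at_top sequentially"
    using \<alpha> by real_asymp
  then have "\<forall>\<^sub>F N in sequentially. K \<le> (real (Suc N) powr \<alpha> - 1) / 2"
    by (simp add: filterlim_at_top)
  then obtain N where N: "K \<le> (real (Suc N) powr \<alpha> - 1) / 2"
    by (auto simp: eventually_sequentially)
  \<comment> \<open>The \<open>max\<close> with 0 keeps \<open>s\<close> in the range where
    \<open>v_minus_ge\<close> applies.\<close>
  have "max 0 (\<phi> / (1 - \<phi>) - \<phi> ^ N / 2) < \<phi> / (1 - \<phi>)" using \<phi> by simp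
  then have "\<forall>\<^sub>F s in at_left (\<phi> / (1 - \<phi>)). s \<in> {max 0 (\<phi> / (1 - \<phi>) - \<phi> ^ N / 2)<..<\<phi> / (1 - \<phi>)}"
    by (intro eventually_at_leftI[of "max 0 (\<phi> / (1 - \<phi>) - \<phi> ^ N / 2)"]) auto
  then show "\<forall>\<^sub>F s in at_left (\<phi> / (1 - \<phi>)). K \<le> v_minus \<alpha> \<delta> \<phi> s"
  proof eventually_elim
    case (elim s)
    then have "(real (Suc N) powr \<alpha> - 1) / 2 \<le> v_minus \<alpha> \<delta> \<phi> s"
      using \<phi> \<alpha> \<delta> by (intro v_minus_ge) auto
    then show ?case using N by simp
  qed
qed

section \<open>The merged problem\<close>

lemma mem_arg_sup_iff: "x \<in> arg_sup g D \<longleftrightarrow> x \<in> D \<and> (\<forall>y\<in>D. g y \<le> g x)"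
proof -
  have "ereal (g x) = (SUP y\<in>D. ereal (g y)) \<longleftrightarrow> (\<forall>y\<in>D. g y \<le> g x)" if x: "x \<in> D"
  proof -
    have "ereal (g x) \<le> (SUP y\<in>D. ereal (g y))" using x by (rule SUP_upper)
    then have "ereal (g x) = (SUP y\<in>D. ereal (g y)) \<longleftrightarrow> (SUP y\<in>D. ereal (g y)) \<le> ereal (g x)"
      by auto
    then show ?thesis by (simp add: SUP_le_iff)
  qed
  then show ?thesis by (auto simp: arg_sup_def)
qed

text \<open>With \<open>b \<le> a\<close> the difference is \<open>y powr b * (A * y powr (a - b) - B)\<close>, a product of
  nondecreasing factors.\<close>

lemma powr_diff_less_of_ge:
  fixes A B a b y m :: real
  assumes A: "0 \<le> A" and ab: "0 < b" "b \<le> a"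
    and y: "0 \<le> y" "y < m" and pos: "0 < A * y powr a - B * y powr b"
  shows "A * y powr a - B * y powr b < A * m powr a - B * m powr b"
proof -
  have eq: "A * x powr a - B * x powr b = x powr b * (A * x powr (a - b) - B)" if "0 < x" for x
    using that by (simp add: right_diff_distrib mult_ac flip: powr_add)
  have y0: "0 < y" using pos y(1) by (cases "y = 0") auto
  \<comment> \<open>A positive product forces the second factor to be positive, so the strict growth
    of \<open>y powr b\<close> carries over to the product.\<close>
  have "0 < A * y powr (a - b) - B"
    using pos y0 unfolding eq[OF y0] by (simp add: zero_less_mult_iff)
  moreover have "A * y powr (a - b) \<le> A * m powr (a - b)"
    using A y ab by (intro mult_left_mono powr_mono2) auto
  ultimately have "y powr b * (A * y powr (a - b) - B) < m powr b * (A * m powr (a - b) - B)"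
    using y y0 ab by (intro mult_less_le_imp_less powr_less_mono2) auto
  then show ?thesis using y y0 by (simp add: eq)
qed

text \<open>The difference increases up to its critical point and decreases afterwards.\<close>

lemma powr_diff_less_max:
  fixes A B a b y m :: real
  assumes AB: "0 < A" "0 < B" and ab: "0 < a" "a < b" and y: "0 \<le> y" "y \<le> m"
  defines "k \<equiv> min ((a * A / (b * B)) powr (1 / (b - a))) m"
  assumes yk: "y \<noteq> k"
  shows "A * y powr a - B * y powr b < A * k powr a - B * k powr b"
proof -
  define g where "g = (\<lambda>y. A * y powr a - B * y powr b)"
  define q where "q = a * A / (b * B)"
  define c where "c = q powr (1 / (b - a))"
  have q: "0 < q" using AB ab by (simp add: q_def)
  have c: "0 < c" "c powr (b - a) = q" using q ab by (auto simp: c_def powr_powr)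
  have cont: "continuous_on {u..v} g" if "0 \<le> u" for u v
    unfolding g_def using that ab by (intro continuous_intros continuous_on_powr') auto
  have deriv: "(g has_real_derivative (x powr (a - 1) * (b * B)) * (q - x powr (b - a))) (at x)"
    if "0 < x" for x
  proof -
    have "x powr (b - 1) = x powr (a - 1) * x powr (b - a)"
      using that by (simp flip: powr_add)
    then have "(x powr (a - 1) * (b * B)) * (q - x powr (b - a)) =
        A * (a * x powr (a - 1)) - B * (b * x powr (b - 1))"
      using AB ab by (simp add: q_def algebra_simps)
    then show ?thesis
      unfolding g_def using that by (auto intro!: derivative_eq_intros)
  qed
  \<comment> \<open>If \<open>y\<close> lies above \<open>k\<close>, then \<open>k < m\<close>
    because \<open>y \<le> m\<close>, so the minimum is the critical point \<open>c\<close>.\<close>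
  consider "y < k" | "c \<le> k" "k = c" "k < y"
    using yk y unfolding k_def c_def q_def by linarith
  then have "g y < g k"
  proof cases
    case 1
    show ?thesis
    proof (rule DERIV_pos_imp_increasing_open[OF 1 _ cont[OF y(1)]])
      fix x assume x: "y < x" "x < k"
      then have "x < c" "0 < x" using y by (auto simp: k_def c_def q_def)
      then have "x powr (b - a) < q"
        using powr_less_mono2[of "b - a" x c] ab c by simp
      then have "0 < (x powr (a - 1) * (b * B)) * (q - x powr (b - a))"
        using AB ab \<open>0 < x\<close> by simp
      then show "\<exists>d. (g has_real_derivative d) (at x) \<and> 0 < d"
        using deriv[OF \<open>0 < x\<close>] by blast
    qed
  next
    case 2
    show ?thesis
    proof (rule DERIV_neg_imp_decreasing_open[OF 2(3) _ cont])
      fix x assume x: "k < x" "x < y"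
      then have "c < x" "0 < x" using c 2 by auto
      then have "q < x powr (b - a)"
        using powr_less_mono2[of "b - a" c x] ab c by simp
      then have "(x powr (a - 1) * (b * B)) * (q - x powr (b - a)) < 0"
        using AB ab \<open>0 < x\<close> by (intro mult_pos_neg) auto
      then show "\<exists>d. (g has_real_derivative d) (at x) \<and> d < 0"
        using deriv[OF \<open>0 < x\<close>] by blast
    qed (use c 2 in auto)
  qed
  then show ?thesis by (simp add: g_def)
qed

text \<open>Isolates the properties of the value functions that drive the optimization: sign,
  continuity, and behaviour at the two open ends of \<open>s_domain\<close>.\<close>

locale merged_problem =
  fixes \<phi> \<delta>p \<delta>m lam :: real and vp vm :: "real \<Rightarrow> real"
  assumes \<phi>: "0 < \<phi>" "\<phi> < 1" and \<delta>: "0 < \<delta>p" "0 < \<delta>m" and lam: "0 < lam"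
    and vp_nonneg: "0 \<le> vp s" and vm_nonneg: "0 \<le> vm s"
    and continuous_on_vp: "continuous_on {0..} vp"
    and continuous_on_vm: "b < \<phi> / (1 - \<phi>) \<Longrightarrow> continuous_on {0..b} vm"
    and vp_tendsto: "((\<lambda>s. (vp s + 1) / (s + 1) powr \<delta>p) \<longlongrightarrow> 0) at_top"
    and filterlim_vm: "filterlim vm at_top (at_left (\<phi> / (1 - \<phi>)))"
begin

abbreviation "D \<equiv> s_domain \<phi>"
abbreviation "f \<equiv> f_MP vp vm \<phi> \<delta>p \<delta>m lam"
abbreviation "v \<equiv> v_M vp vm \<delta>p \<delta>m lam"
abbreviation "optimal \<equiv> MP_optimal vp vm \<phi> \<delta>p \<delta>m lam"

section \<open>Reduction to one variable\<close>

definition y_max :: "real \<Rightarrow> real \<Rightarrow> real" where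
  "y_max sp sm = (sp + 1) / (sp + 1 + \<phi> * (sm + 1))"

definition point :: "real \<Rightarrow> real \<Rightarrow> real \<Rightarrow> real \<times> real \<times> real \<times> real" where
  "point sp sm y = (\<phi> * ((sm + 1) / (sp + 1)) * y, y, sp, sm)"

lemma D_iff: "(sp, sm) \<in> D \<longleftrightarrow> 0 \<le> sp \<and> 0 \<le> sm \<and> sm < \<phi> / (1 - \<phi>)"
  by (auto simp: s_domain_def)

lemma y_max_pos: "(sp, sm) \<in> D \<Longrightarrow> 0 < y_max sp sm"
  using \<phi> by (auto simp: D_iff y_max_def intro!: divide_pos_pos add_nonneg_pos)

lemma feasible_iff:
  "MP_feasible \<phi> (zp, zm, sp, sm) \<longleftrightarrow>
    (sp, sm) \<in> D \<and> 0 \<le> zm \<and> zm \<le> y_max sp sm \<and> (zp, zm, sp, sm) = point sp sm zm"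
proof (cases "(sp, sm) \<in> D")
  case True
  then have s: "0 < sp + 1" "0 < sm + 1" by (auto simp: D_iff)
  \<comment> \<open>\<open>r\<close> is the ratio of \<open>zp\<close> to \<open>zm\<close> forced
    by the linear constraint; the sum constraint becomes \<open>zm \<le> 1 / (r + 1)\<close> and,
    with nonnegativity, yields both upper bounds 1.\<close>
  define r where "r = \<phi> * ((sm + 1) / (sp + 1))"
  have r: "0 < r" using \<phi> s by (simp add: r_def)
  have con: "(sp + 1) * zp = \<phi> * (sm + 1) * zm \<longleftrightarrow> zp = r * zm"
    using s by (auto simp: r_def field_simps)
  have "zm \<le> y_max sp sm \<longleftrightarrow> (r + 1) * zm \<le> 1"
  proof -
    have "y_max sp sm = 1 / (r + 1)"
      using s \<phi> by (simp add: y_max_def r_def field_simps)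
    then show ?thesis using r by (simp add: pos_le_divide_eq mult.commute)
  qed
  then have "zm \<le> y_max sp sm \<longleftrightarrow> r * zm + zm \<le> 1"
    by (simp add: distrib_right)
  moreover have "0 \<le> r * zm" if "0 \<le> zm" using that r by simp
  moreover have "(zp, zm, sp, sm) = point sp sm zm \<longleftrightarrow> zp = r * zm"
    by (simp add: point_def r_def)
  ultimately show ?thesis
    using True unfolding MP_feasible_def prod.case con by (smt (verit))
qed (simp add: MP_feasible_def)

lemma feasible_point:
  "(sp, sm) \<in> D \<Longrightarrow> 0 \<le> y \<Longrightarrow> y \<le> y_max sp sm \<Longrightarrow> MP_feasible \<phi> (point sp sm y)"
  unfolding point_def feasible_iff by (simp add: point_def)

lemma feasibleE:
  assumes "MP_feasible \<phi> x"
  obtains sp sm y where "x = point sp sm y" "(sp, sm) \<in> D" "0 \<le> y" "y \<le> y_max sp sm"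
  using assms by (cases x) (auto simp: feasible_iff)

lemma v_point: "(sp, sm) \<in> D \<Longrightarrow> 0 \<le> y \<Longrightarrow> v (point sp sm y) = f sp sm y"
  unfolding v_M_def point_def f_MP_def using \<phi>
  by (simp add: powr_mult D_iff mult.assoc del: times_divide_eq_right times_divide_eq_left)

section \<open>Existence of an optimum\<close>

text \<open>For large \<open>sp\<close> the constraint makes \<open>zp\<close> so small that the
  gain is below \<open>V\<close>. For bounded \<open>sp\<close> the gain is bounded, and a value of
  at least \<open>V\<close> keeps \<open>zm\<close> away from 0, so \<open>vm sm\<close> cannot be
  large.\<close>

lemma near_optimal_bounded:
  assumes V: "0 < V"
  obtains S b where "b < \<phi> / (1 - \<phi>)"
    "\<And>zp zm sp sm. MP_feasible \<phi> (zp, zm, sp, sm) \<Longrightarrow> V \<le> v (zp, zm, sp, sm) \<Longrightarrow> sp \<le> S \<and> sm \<le> b"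
proof -
  define Q where "Q = \<phi> / (1 - \<phi>)"
  have Q: "0 < Q" using \<phi> by (simp add: Q_def)
  have zp_le: "(sp + 1) * zp \<le> Q * zm" "0 \<le> zp" "zp \<le> 1" "0 \<le> zm" "zm \<le> 1" "0 \<le> sp" "0 \<le> sm" "sm < Q"
    if "MP_feasible \<phi> (zp, zm, sp, sm)" for zp zm sp sm
  proof -
    show *: "0 \<le> zp" "zp \<le> 1" "0 \<le> zm" "zm \<le> 1" "0 \<le> sp" "0 \<le> sm" "sm < Q"
      using that by (auto simp: MP_feasible_def D_iff Q_def)
    have "\<phi> * (sm + 1) \<le> \<phi> * (Q + 1)" using * \<phi> by (intro mult_left_mono) auto
    \<comment> \<open>\<open>Q\<close> solves \<open>\<phi> * (Q + 1) = Q\<close>, so it bounds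
      \<open>\<phi> * (sm + 1)\<close> on the domain.\<close>
    also have "\<dots> = Q" using \<phi> by (simp add: Q_def field_simps)
    finally show "(sp + 1) * zp \<le> Q * zm"
      using that * by (simp add: MP_feasible_def mult_right_mono)
  qed
  have loss: "0 \<le> lam * (vm sm + 1) * zm powr \<delta>m" for sm zm
    using lam vm_nonneg[of sm] by simp

  have "((\<lambda>s. Q powr \<delta>p * ((vp s + 1) / (s + 1) powr \<delta>p)) \<longlongrightarrow> Q powr \<delta>p * 0) at_top"
    by (intro tendsto_intros vp_tendsto)
  then have "\<forall>\<^sub>F s in at_top. Q powr \<delta>p * ((vp s + 1) / (s + 1) powr \<delta>p) < V"
    using V by (intro order_tendstoD(2)) auto
  then obtain S where S: "\<And>s. S \<le> s \<Longrightarrow> Q powr \<delta>p * ((vp s + 1) / (s + 1) powr \<delta>p) < V"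
    by (auto simp: eventually_at_top_linorder)
  have sp_le: "sp \<le> S" if "MP_feasible \<phi> (zp, zm, sp, sm)" "V \<le> v (zp, zm, sp, sm)" for zp zm sp sm
  proof (rule ccontr)
    assume "\<not> sp \<le> S"
    note z = zp_le[OF that(1)]
    have "(sp + 1) * zp \<le> Q" using z(1,5) Q mult_left_mono[of zm 1 Q] by linarith
    then have "zp \<le> Q / (sp + 1)" using z by (simp add: field_simps)
    then have "zp powr \<delta>p \<le> Q powr \<delta>p / (sp + 1) powr \<delta>p"
      using powr_mono2[of \<delta>p zp "Q / (sp + 1)"] z \<delta> Q by (simp add: powr_divide)
    then have "(vp sp + 1) * zp powr \<delta>p \<le> (vp sp + 1) * (Q powr \<delta>p / (sp + 1) powr \<delta>p)"
      using vp_nonneg[of sp] by (intro mult_left_mono) auto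
    moreover have "V \<le> (vp sp + 1) * zp powr \<delta>p"
      using that(2) loss[of sm zm] by (simp add: v_M_def)
    ultimately show False using S[of sp] \<open>\<not> sp \<le> S\<close> by (simp add: mult_ac)
  qed

  have "compact (vp ` {0..S})"
    by (intro compact_continuous_image continuous_on_subset[OF continuous_on_vp]) auto
  then have "bdd_above (vp ` {0..S})"
    by (intro bounded_imp_bdd_above compact_imp_bounded)
  then obtain P0 where "\<forall>s\<in>{0..S}. vp s \<le> P0"
    by (auto simp: bdd_above_def)
  then have P0: "vp s \<le> P0" if "0 \<le> s" "s \<le> S" for s
    using that by simp
  \<comment> \<open>The \<open>max\<close> keeps \<open>P\<close> positive even when
    \<open>{0..S}\<close> is empty.\<close>
  define P where "P = max P0 0 + 1"
  have P: "0 < P" "\<And>s. 0 \<le> s \<Longrightarrow> s \<le> S \<Longrightarrow> vp s + 1 \<le> P"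
    using P0 by (auto simp: P_def max_def intro: order_trans)
  \<comment> \<open>The lower bound for \<open>zm\<close> obtained by solving
    \<open>V \<le> P * (Q * zm) powr \<delta>p\<close>.\<close>
  define \<eta> where "\<eta> = (V / P) powr (1 / \<delta>p) / Q"
  have \<eta>: "0 < \<eta>" using V P Q by (simp add: \<eta>_def)
  have vm_le: "vm sm \<le> P / (lam * \<eta> powr \<delta>m)"
    if x: "MP_feasible \<phi> (zp, zm, sp, sm)" "V \<le> v (zp, zm, sp, sm)" for zp zm sp sm
  proof -
    note z = zp_le[OF x(1)]
    have vP: "vp sp + 1 \<le> P" using P(2) z sp_le[OF x] by blast
    have V_le: "V \<le> P * zp powr \<delta>p - lam * (vm sm + 1) * zm powr \<delta>m"
      using x(2) mult_right_mono[OF vP, of "zp powr \<delta>p"] by (simp add: v_M_def)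
    have "1 * zp \<le> (sp + 1) * zp" using z by (intro mult_right_mono) auto
    then have "zp \<le> Q * zm" using z by linarith
    then have "zp powr \<delta>p \<le> (Q * zm) powr \<delta>p" using z \<delta> by (intro powr_mono2) auto
    then have "V \<le> P * (Q * zm) powr \<delta>p"
      using V_le loss[of sm zm] P mult_left_mono[of "zp powr \<delta>p" "(Q * zm) powr \<delta>p" P] by linarith
    then have "V / P \<le> (Q * zm) powr \<delta>p" using P by (simp add: field_simps)
    then have "(V / P) powr (1 / \<delta>p) \<le> ((Q * zm) powr \<delta>p) powr (1 / \<delta>p)"
      using V P \<delta> by (intro powr_mono2) auto
    also have "\<dots> = Q * zm" using z Q \<delta> by (simp add: powr_powr)
    finally have "\<eta> \<le> zm" using Q by (simp add: \<eta>_def field_simps)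
    then have "lam * (vm sm + 1) * \<eta> powr \<delta>m \<le> lam * (vm sm + 1) * zm powr \<delta>m"
      using lam vm_nonneg[of sm] \<eta> \<delta> by (intro mult_left_mono powr_mono2) auto
    \<comment> \<open>Since the value is positive, the loss stays below the gain, which is at most
      \<open>P\<close>.\<close>
    also have "\<dots> \<le> P"
    proof -
      have "zp powr \<delta>p \<le> 1" using z \<delta> by (intro powr_le1) auto
      then have "P * zp powr \<delta>p \<le> P * 1" using P(1) by (intro mult_left_mono) auto
      then show ?thesis using V_le V by linarith
    qed
    finally have "vm sm + 1 \<le> P / (lam * \<eta> powr \<delta>m)"
      using lam \<eta> by (simp add: field_simps)
    then show ?thesis by simp
  qed

  have "\<forall>\<^sub>F s in at_left Q. P / (lam * \<eta> powr \<delta>m) < vm s"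
    using filterlim_vm unfolding Q_def[symmetric] by (simp add: filterlim_at_top_dense)
  then obtain b where b: "b < Q" "\<And>s. b < s \<Longrightarrow> s < Q \<Longrightarrow> P / (lam * \<eta> powr \<delta>m) < vm s"
    using eventually_at_left[of "Q - 1" Q] by auto
  show ?thesis
  proof
    show "b < \<phi> / (1 - \<phi>)" using b by (simp add: Q_def)
    fix zp zm sp sm assume x: "MP_feasible \<phi> (zp, zm, sp, sm)" "V \<le> v (zp, zm, sp, sm)"
    show "sp \<le> S \<and> sm \<le> b"
      using sp_le[OF x] vm_le[OF x] b(2)[of sm] zp_le(8)[OF x(1)] by force
  qed
qed

text \<open>The constraint set becomes compact once \<open>sp \<le> S\<close> and
  \<open>sm \<le> b\<close> are imposed, and every feasible point outside is worse than
  \<open>x0\<close>.\<close>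

lemma optimal_exists:
  assumes x0: "MP_feasible \<phi> x0" "0 < v x0"
  obtains x where "optimal x"
proof -
  obtain S b where b: "b < \<phi> / (1 - \<phi>)" and bounded: "\<And>zp zm sp sm. MP_feasible \<phi> (zp, zm, sp, sm) \<Longrightarrow>
      v x0 \<le> v (zp, zm, sp, sm) \<Longrightarrow> sp \<le> S \<and> sm \<le> b"
    using near_optimal_bounded[OF x0(2)] by metis
  define C :: "(real \<times> real \<times> real \<times> real) set" where
    "C = {0..1} \<times> {0..1} \<times> {0..S} \<times> {0..b} \<inter> {x. fst x + fst (snd x) \<le> 1} \<inter>
      {x. (fst (snd (snd x)) + 1) * fst x = \<phi> * (snd (snd (snd x)) + 1) * fst (snd x)}"
  have C_iff: "x \<in> C \<longleftrightarrow> MP_feasible \<phi> x \<and> fst (snd (snd x)) \<le> S \<and> snd (snd (snd x)) \<le> b" for x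
    using b by (cases x) (auto simp: C_def MP_feasible_def s_domain_def)
  have "compact C"
    unfolding C_def
    by (intro compact_Int_closed compact_Times closed_Collect_le closed_Collect_eq continuous_intros)
       auto
  moreover have "x0 \<in> C"
    using x0 bounded by (cases x0) (auto simp: C_iff)
  moreover have "continuous_on C v"
  proof -
    have "continuous_on C (\<lambda>x. vp (fst (snd (snd x))))"
      by (rule continuous_on_compose2[OF continuous_on_vp]) (auto simp: C_def intro!: continuous_intros)
    moreover have "continuous_on C (\<lambda>x. vm (snd (snd (snd x))))"
      by (rule continuous_on_compose2[OF continuous_on_vm[OF b]]) (auto simp: C_def intro!: continuous_intros)
    ultimately show ?thesis
      unfolding v_M_def case_prod_unfold using \<delta>
      by (intro continuous_intros continuous_on_powr') (auto simp: C_def)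
  qed
  ultimately obtain x where x: "x \<in> C" "\<And>y. y \<in> C \<Longrightarrow> v y \<le> v x"
    using continuous_attains_sup[of C v] by blast
  have "v y \<le> v x" if "MP_feasible \<phi> y" for y
  proof (cases "v x0 \<le> v y")
    case True
    then have "y \<in> C" using that bounded by (cases y) (auto simp: C_iff)
    then show ?thesis by (rule x(2))
  next
    case False
    then show ?thesis using x(2)[OF \<open>x0 \<in> C\<close>] by simp
  qed
  then have "optimal x"
    using x(1) by (auto simp: MP_optimal_def is_arg_max_def C_iff not_less)
  then show ?thesis by (rule that)
qed

section \<open>Description of all optimal points\<close>

lemma optimal_iff: "optimal x \<longleftrightarrow> MP_feasible \<phi> x \<and> (\<forall>y. MP_feasible \<phi> y \<longrightarrow> v y \<le> v x)"
  by (auto simp: MP_optimal_def is_arg_max_def not_less)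

text \<open>Serves both cases, with \<open>\<kappa>\<close> the unique maximizer in \<open>y\<close>
  wherever \<open>f\<close> takes positive values. Strictness determines \<open>y\<close> at an
  optimum; one positive value gives existence and excludes \<open>(0, 0)\<close>.\<close>

lemma optimal_characterization:
  assumes \<kappa>: "\<And>sp sm. (sp, sm) \<in> D \<Longrightarrow> 0 \<le> \<kappa> sp sm \<and> \<kappa> sp sm \<le> y_max sp sm"
    and better: "\<And>sp sm y. (sp, sm) \<in> D \<Longrightarrow> 0 \<le> y \<Longrightarrow> y \<le> y_max sp sm \<Longrightarrow> 0 < f sp sm y \<Longrightarrow>
      y \<noteq> \<kappa> sp sm \<Longrightarrow> f sp sm y < f sp sm (\<kappa> sp sm)"
    and pos: "(sp0, sm0) \<in> D" "0 < f sp0 sm0 (\<kappa> sp0 sm0)"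
  shows "enters vp vm \<phi> \<delta>p \<delta>m lam"
    and "{x. optimal x} = {point sp sm (\<kappa> sp sm) | sp sm.
      (sp, sm) \<in> arg_sup (\<lambda>(sp, sm). f sp sm (\<kappa> sp sm)) D}"
proof -
  have feas: "MP_feasible \<phi> (point sp sm (\<kappa> sp sm))" "v (point sp sm (\<kappa> sp sm)) = f sp sm (\<kappa> sp sm)"
    if "(sp, sm) \<in> D" for sp sm
    using that \<kappa> by (auto intro!: feasible_point v_point)
  have optimal_pos: "0 < v x" if "optimal x" for x
    using that feas[OF pos(1)] pos(2) unfolding optimal_iff by (metis less_le_trans)
  have "0 < v (point sp0 sm0 (\<kappa> sp0 sm0))"
    using feas(2)[OF pos(1)] pos(2) by simp
  then obtain x where "optimal x"
    using optimal_exists[OF feas(1)[OF pos(1)]] by blast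
  moreover have "(zp, zm) \<noteq> (0, 0)" if "optimal (zp, zm, sp, sm)" for zp zm sp sm
    using optimal_pos[OF that] by (auto simp: v_M_def)
  ultimately show "enters vp vm \<phi> \<delta>p \<delta>m lam"
    unfolding enters_def by blast
  show "{x. optimal x} = {point sp sm (\<kappa> sp sm) | sp sm.
      (sp, sm) \<in> arg_sup (\<lambda>(sp, sm). f sp sm (\<kappa> sp sm)) D}" (is "?L = ?R")
  proof (intro equalityI subsetI)
    fix x assume "x \<in> ?L"
    then have x: "optimal x" by simp
    then obtain sp sm y where y: "x = point sp sm y" "(sp, sm) \<in> D" "0 \<le> y" "y \<le> y_max sp sm"
      by (auto simp: optimal_iff elim: feasibleE)
    have vx: "v x = f sp sm y" using y v_point by simp
    have le: "f s t (\<kappa> s t) \<le> v x" if "(s, t) \<in> D" for s t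
      using x feas[OF that] by (metis optimal_iff)
    then have "y = \<kappa> sp sm"
      using better[OF y(2-4)] optimal_pos[OF x] y(2) vx by force
    moreover from this have "(sp, sm) \<in> arg_sup (\<lambda>(sp, sm). f sp sm (\<kappa> sp sm)) D"
      using le y(2) vx by (auto simp: mem_arg_sup_iff)
    ultimately show "x \<in> ?R"
      using y(1) by blast
  next
    fix x assume "x \<in> ?R"
    then obtain sp sm where x: "x = point sp sm (\<kappa> sp sm)" "(sp, sm) \<in> D"
      and "\<forall>z\<in>D. (\<lambda>(s, t). f s t (\<kappa> s t)) z \<le> f sp sm (\<kappa> sp sm)"
      by (auto simp only: mem_arg_sup_iff prod.case)
    then have max: "f s t (\<kappa> s t) \<le> f sp sm (\<kappa> sp sm)" if "(s, t) \<in> D" for s t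
      using that by force
    have "v z \<le> v x" if "MP_feasible \<phi> z" for z
    proof -
      obtain s t y where y: "z = point s t y" "(s, t) \<in> D" "0 \<le> y" "y \<le> y_max s t"
        using \<open>MP_feasible \<phi> z\<close> by (rule feasibleE)
      \<comment> \<open>\<open>better\<close> covers positive values of \<open>f s t y\<close>; a
        nonpositive one lies below the positive value at \<open>(sp0, sm0)\<close>.\<close>
      have "f s t y \<le> f sp sm (\<kappa> sp sm)"
        using better[OF y(2-4)] max[OF y(2)] max[OF pos(1)] pos(2) by force
      then show ?thesis using x y feas[OF x(2)] v_point by simp
    qed
    then show "x \<in> ?L" using feas[OF x(2)] x(1) by (auto simp: optimal_iff)
  qed
qed

section \<open>The case \<open>\<delta>m \<le> \<delta>p\<close>\<close>

lemma f_less_y_max: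
  assumes "\<delta>m \<le> \<delta>p" "(sp, sm) \<in> D" "0 \<le> y" "y \<le> y_max sp sm" "0 < f sp sm y" "y \<noteq> y_max sp sm"
  shows "f sp sm y < f sp sm (y_max sp sm)"
  using assms \<delta> vp_nonneg[of sp] unfolding f_MP_def
  by (intro powr_diff_less_of_ge) auto

text \<open>Multiplying \<open>f\<close> at \<open>y_max\<close> by \<open>d powr \<delta>p\<close>,
  with \<open>d\<close> the denominator of \<open>y_max\<close>, turns its sign into a comparison of
  \<open>lam\<close> with the quotient under the supremum \<open>M_MP\<close>.\<close>

lemma f_y_max_pos_iff:
  assumes "(sp, sm) \<in> D"
  shows "0 < f sp sm (y_max sp sm) \<longleftrightarrow> lam <
    ((vp sp + 1) * \<phi> powr \<delta>p * (sm + 1) powr \<delta>p) /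
    ((vm sm + 1) * (sp + 1) powr \<delta>m * (sp + 1 + \<phi> * (sm + 1)) powr (\<delta>p - \<delta>m))"
proof -
  define d where "d = sp + 1 + \<phi> * (sm + 1)"
  have pos: "0 < sp + 1" "0 < sm + 1" "0 < d" "0 < vm sm + 1"
    using assms \<phi> vm_nonneg[of sm] by (auto simp: D_iff d_def intro!: add_nonneg_pos)
  define X where "X = (vp sp + 1) * \<phi> powr \<delta>p * (sm + 1) powr \<delta>p"
  define Y where "Y = (vm sm + 1) * (sp + 1) powr \<delta>m * d powr (\<delta>p - \<delta>m)"
  have Y: "0 < Y" using pos by (simp add: Y_def)
  have "f sp sm (y_max sp sm) = (X - lam * Y) / d powr \<delta>p"
    using pos unfolding f_MP_def y_max_def d_def[symmetric] X_def Y_def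
    by (simp add: powr_divide powr_diff field_simps)
  then have "0 < f sp sm (y_max sp sm) \<longleftrightarrow> lam * Y < X"
    using pos by (simp add: zero_less_divide_iff)
  also have "\<dots> \<longleftrightarrow> lam < X / Y" using Y by (simp add: field_simps)
  finally show ?thesis unfolding X_def Y_def d_def .
qed

text \<open>Every quotient is at most \<open>lam\<close>, so \<open>f\<close> is nonpositive at
  \<open>y_max\<close>; a positive value elsewhere would be exceeded there.\<close>

lemma does_not_enter_of_M_le:
  assumes \<delta>': "\<delta>m \<le> \<delta>p" and M: "M_MP vp vm \<phi> \<delta>p \<delta>m \<le> ereal lam"
  shows "does_not_enter vp vm \<phi> \<delta>p \<delta>m lam"
proof -
  have le: "f sp sm (y_max sp sm) \<le> 0" if "(sp, sm) \<in> D" for sp sm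
    using M f_y_max_pos_iff[OF that] that by (force simp: M_MP_def SUP_le_iff not_less)
  have "v x \<le> 0" if "MP_feasible \<phi> x" for x
  proof -
    obtain sp sm y where y: "x = point sp sm y" "(sp, sm) \<in> D" "0 \<le> y" "y \<le> y_max sp sm"
      using \<open>MP_feasible \<phi> x\<close> by (rule feasibleE)
    then show ?thesis
      using f_less_y_max[OF \<delta>' y(2-4)] le[OF y(2)] v_point by force
  qed
  then have "optimal (0, 0, sp, sm)" if "(sp, sm) \<in> D" for sp sm
    using that by (auto simp: optimal_iff MP_feasible_def v_M_def)
  then show ?thesis by (auto simp: does_not_enter_def)
qed

lemma M_lessE:
  assumes "ereal lam < M_MP vp vm \<phi> \<delta>p \<delta>m"
  obtains sp sm where "(sp, sm) \<in> D" "0 < f sp sm (y_max sp sm)"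
  using assms f_y_max_pos_iff unfolding M_MP_def less_SUP_iff by fastforce

section \<open>The case \<open>\<delta>p < \<delta>m\<close>\<close>

text \<open>Puts \<open>k_MP\<close> in the shape of \<open>k\<close> in
  \<open>powr_diff_less_max\<close>, with the coefficients of \<open>f\<close> as \<open>A\<close>
  and \<open>B\<close>.\<close>

lemma k_MP_eq:
  assumes "(sp, sm) \<in> D"
  shows "k_MP vp vm \<phi> \<delta>p \<delta>m lam sp sm = min ((\<delta>p * ((vp sp + 1) * \<phi> powr \<delta>p * ((sm + 1) / (sp + 1)) powr \<delta>p) /
    (\<delta>m * (lam * (vm sm + 1)))) powr (1 / (\<delta>m - \<delta>p))) (y_max sp sm)"
proof -
  have "\<delta>p * ((vp sp + 1) * \<phi> powr \<delta>p * ((sm + 1) / (sp + 1)) powr \<delta>p) / (\<delta>m * (lam * (vm sm + 1))) =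
      \<delta>p * (vp sp + 1) * \<phi> powr \<delta>p * (sm + 1) powr \<delta>p / (lam * \<delta>m * (vm sm + 1) * (sp + 1) powr \<delta>p)"
    using assms by (simp add: powr_divide D_iff mult_ac)
  then show ?thesis by (simp add: k_MP_def y_max_def)
qed

lemma f_coeff_pos:
  assumes "(sp, sm) \<in> D"
  shows "0 < (vp sp + 1) * \<phi> powr \<delta>p * ((sm + 1) / (sp + 1)) powr \<delta>p" "0 < lam * (vm sm + 1)"
  using assms \<phi> lam vp_nonneg[of sp] vm_nonneg[of sm] by (auto simp: D_iff)

lemma k_MP_bounds:
  assumes "(sp, sm) \<in> D"
  shows "0 < k_MP vp vm \<phi> \<delta>p \<delta>m lam sp sm" "k_MP vp vm \<phi> \<delta>p \<delta>m lam sp sm \<le> y_max sp sm"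
proof -
  have "0 < \<delta>p * ((vp sp + 1) * \<phi> powr \<delta>p * ((sm + 1) / (sp + 1)) powr \<delta>p) / (\<delta>m * (lam * (vm sm + 1)))"
    by (intro divide_pos_pos mult_pos_pos[OF \<delta>(1)] mult_pos_pos[OF \<delta>(2)] f_coeff_pos[OF assms])
  then show "0 < k_MP vp vm \<phi> \<delta>p \<delta>m lam sp sm" "k_MP vp vm \<phi> \<delta>p \<delta>m lam sp sm \<le> y_max sp sm"
    using y_max_pos[OF assms] unfolding k_MP_eq[OF assms] by auto
qed

lemma f_less_k_MP:
  assumes "\<delta>p < \<delta>m" "(sp, sm) \<in> D" "0 \<le> y" "y \<le> y_max sp sm" "y \<noteq> k_MP vp vm \<phi> \<delta>p \<delta>m lam sp sm"
  shows "f sp sm y < f sp sm (k_MP vp vm \<phi> \<delta>p \<delta>m lam sp sm)"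
  using powr_diff_less_max[OF f_coeff_pos[OF assms(2)] \<delta>(1) assms(1,3,4)] assms(5)
  unfolding k_MP_eq[OF assms(2)] f_MP_def by simp

end

section \<open>Application to \<open>v_plus\<close> and \<open>v_minus\<close>\<close>

theorem proposition5p6:
  fixes p \<rho> \<phi> \<alpha>p \<alpha>m \<delta>p \<delta>m lam :: real
    and vp vm :: "real \<Rightarrow> real"
  assumes p: "0 < p" "p < 1/2"
    and rho: "\<rho> = (1 - p) / p"
    and phi: "\<phi> = 1 / \<rho>"
    and alpha: "0 < \<alpha>p" "\<alpha>p < 1" "0 < \<alpha>m" "\<alpha>m < 1"
    and delta: "0 < \<delta>p" "\<delta>p \<le> 1" "0 < \<delta>m" "\<delta>m \<le> 1"
    and lam: "1 \<le> lam"
    and vp: "vp = v_plus \<alpha>p \<delta>p \<rho>"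
    and vm: "vm = v_minus \<alpha>m \<delta>m \<phi>"
  shows
    "(\<delta>p \<ge> \<delta>m \<longrightarrow>
        (ereal lam \<ge> M_MP vp vm \<phi> \<delta>p \<delta>m \<longrightarrow> does_not_enter vp vm \<phi> \<delta>p \<delta>m lam) \<and>
        (ereal lam < M_MP vp vm \<phi> \<delta>p \<delta>m \<longrightarrow>
           enters vp vm \<phi> \<delta>p \<delta>m lam \<and>
           {x. MP_optimal vp vm \<phi> \<delta>p \<delta>m lam x} =
             {(\<phi> * (sm + 1) / (sp + 1 + \<phi> * (sm + 1)), (sp + 1) / (sp + 1 + \<phi> * (sm + 1)), sp, sm)
               | sp sm. (sp, sm) \<in> arg_sup
                   (\<lambda>(sp, sm). f_MP vp vm \<phi> \<delta>p \<delta>m lam sp sm ((sp + 1) / (sp + 1 + \<phi> * (sm + 1))))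
                   (s_domain \<phi>)}))
     \<and>
     (\<delta>p < \<delta>m \<longrightarrow>
        enters vp vm \<phi> \<delta>p \<delta>m lam \<and>
        {x. MP_optimal vp vm \<phi> \<delta>p \<delta>m lam x} =
          {(\<phi> * ((sm + 1) / (sp + 1)) * k_MP vp vm \<phi> \<delta>p \<delta>m lam sp sm,
            k_MP vp vm \<phi> \<delta>p \<delta>m lam sp sm, sp, sm)
            | sp sm. (sp, sm) \<in> arg_sup
                (\<lambda>(sp, sm). f_MP vp vm \<phi> \<delta>p \<delta>m lam sp sm (k_MP vp vm \<phi> \<delta>p \<delta>m lam sp sm))
                (s_domain \<phi>)})"
proof -
  have rho1: "1 < \<rho>" using p by (simp add: rho field_simps)
  then have phi01: "0 < \<phi>" "\<phi> < 1" by (auto simp: phi)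
  interpret merged_problem \<phi> \<delta>p \<delta>m lam vp vm
  proof
    show "continuous_on {0..} vp" "((\<lambda>s. (vp s + 1) / (s + 1) powr \<delta>p) \<longlongrightarrow> 0) at_top"
      using rho1 alpha delta continuous_on_v_plus v_plus_tendsto by (auto simp: vp)
    show "continuous_on {0..b} vm" if "b < \<phi> / (1 - \<phi>)" for b
      using that phi01 alpha delta continuous_on_v_minus by (auto simp: vm)
    show "filterlim vm at_top (at_left (\<phi> / (1 - \<phi>)))"
      using phi01 alpha delta filterlim_v_minus by (auto simp: vm)
  qed (use phi01 delta lam in \<open>auto simp: vp vm v_plus_nonneg v_minus_nonneg\<close>)
  \<comment> \<open>On the domain \<open>sp + 1\<close> is nonzero and cancels in the first
    coordinate.\<close>
  have point_y_max: "point sp sm (y_max sp sm) =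
      (\<phi> * (sm + 1) / (sp + 1 + \<phi> * (sm + 1)), (sp + 1) / (sp + 1 + \<phi> * (sm + 1)), sp, sm)"
    if "(sp, sm) \<in> D" for sp sm
    using that by (auto simp: point_def y_max_def D_iff)
  show ?thesis
  proof (intro conjI impI)
    assume "\<delta>m \<le> \<delta>p" "M_MP vp vm \<phi> \<delta>p \<delta>m \<le> ereal lam"
    then show "does_not_enter vp vm \<phi> \<delta>p \<delta>m lam" by (rule does_not_enter_of_M_le)
  next
    assume \<delta>': "\<delta>m \<le> \<delta>p" and M: "ereal lam < M_MP vp vm \<phi> \<delta>p \<delta>m"
    obtain sp0 sm0 where pos: "(sp0, sm0) \<in> D" "0 < f sp0 sm0 (y_max sp0 sm0)"
      using M by (rule M_lessE)
    note char = optimal_characterization[of y_max, OF _ f_less_y_max[OF \<delta>'] pos]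
    show "enters vp vm \<phi> \<delta>p \<delta>m lam"
      using y_max_pos by (intro char(1)) (auto intro: less_imp_le)
    have "{x. optimal x} = {point sp sm (y_max sp sm) | sp sm.
        (sp, sm) \<in> arg_sup (\<lambda>(sp, sm). f sp sm (y_max sp sm)) D}"
      using y_max_pos by (intro char(2)) (auto intro: less_imp_le)
    also have "\<dots> = {(\<phi> * (sm + 1) / (sp + 1 + \<phi> * (sm + 1)), y_max sp sm, sp, sm) | sp sm.
        (sp, sm) \<in> arg_sup (\<lambda>(sp, sm). f sp sm (y_max sp sm)) D}"
      \<comment> \<open>\<open>rev_conj_cong\<close> makes membership in the \<open>arg_sup\<close>,
        hence in \<open>D\<close>, available when the point is rewritten.\<close>
      by (intro Collect_cong ex_cong1 rev_conj_cong refl)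
         (simp only: point_y_max mem_arg_sup_iff flip: y_max_def)
    finally show "{x. MP_optimal vp vm \<phi> \<delta>p \<delta>m lam x} =
        {(\<phi> * (sm + 1) / (sp + 1 + \<phi> * (sm + 1)), (sp + 1) / (sp + 1 + \<phi> * (sm + 1)), sp, sm)
          | sp sm. (sp, sm) \<in> arg_sup
              (\<lambda>(sp, sm). f_MP vp vm \<phi> \<delta>p \<delta>m lam sp sm ((sp + 1) / (sp + 1 + \<phi> * (sm + 1))))
              (s_domain \<phi>)}"
      unfolding y_max_def .
  next
    assume \<delta>': "\<delta>p < \<delta>m"
    let ?k = "k_MP vp vm \<phi> \<delta>p \<delta>m lam"
    have D0: "(0, 0) \<in> D" using phi01 by (simp add: D_iff)
    \<comment> \<open>\<open>f\<close> vanishes at \<open>y = 0\<close>, and \<open>?k 0 0\<close>,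
      being positive, is strictly better.\<close>
    have "0 < f 0 0 (?k 0 0)"
      using f_less_k_MP[OF \<delta>' D0, of 0] k_MP_bounds[OF D0] y_max_pos[OF D0] by (simp add: f_MP_def)
    note char = optimal_characterization[of ?k, OF _ f_less_k_MP[OF \<delta>'] D0 this]
    show "enters vp vm \<phi> \<delta>p \<delta>m lam"
      using k_MP_bounds by (intro char(1)) (auto intro: less_imp_le)
    show "{x. MP_optimal vp vm \<phi> \<delta>p \<delta>m lam x} =
        {(\<phi> * ((sm + 1) / (sp + 1)) * ?k sp sm, ?k sp sm, sp, sm)
          | sp sm. (sp, sm) \<in> arg_sup (\<lambda>(sp, sm). f_MP vp vm \<phi> \<delta>p \<delta>m lam sp sm (?k sp sm)) (s_domain \<phi>)}"
      using k_MP_bounds unfolding point_def[symmetric]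
      by (intro char(2)) (auto intro: less_imp_le)
  qed
qed

end
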